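(* For any $T\in\mathcal T_h^\Gamma$ with vertices $\mathbf a_{i,T}$, $i=1,\dots,N+1$, a function $(\mathbf v,q)\in\widetilde{\boldsymbol P_1P_1}(T)$ is uniquely determined by the nodal values $\mathbf v(\mathbf a_{i,T})$ and $q(\mathbf a_{i,T})$, $i=1,\dots,N+1$. Furthermore, $$(\mathbf v,q)=(I_{h,T}\mathbf v,I_{h,T}q)+\sum_{i=1}^{N-1}\big(c_i(w_T-I_{h,T}w_T)\mathbf t_{i,h},\,0\big)+\big(\mathbf 0,\,c_N(z_T-I_{h,T}z_T)\big),$$ where $c_1,\dots,c_N$ are determined by $$\big(1+(\mu^-/\mu^+-1)\nabla I_{h,T}w_T\cdot\mathbf n_h\big)c_i=\mathbf t_{i,h}^T\,\sigma(\mu^-/\mu^+-1,I_{h,T}\mathbf v,0)\,\mathbf n_h,\quad i=1,\dots,N-1,$$ $$c_N=\mathbf n_h^T\,\sigma(\mu^--\mu^+,I_{h,T}\mathbf v,0)\,\mathbf n_h.$$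
   Context: Setting. $N\in\{2,3\}$; $\Omega\subset\mathbb R^N$ is an open rectangle ($N=2$) or cuboid ($N=3$); $\Gamma\subset\Omega$ is a closed $C^2$ hypersurface dividing $\Omega$ into $\Omega^-$ (the inclusion, $\partial\Omega^-=\Gamma$) and $\Omega^+$; $\mu^\pm>0$ are constants. $d$ is the signed distance, $d=\pm\mathrm{dist}(\cdot,\Gamma)$ in $\Omega^\pm$. $\{\mathcal T_h\}$ is a shape-regular family of Cartesian simplicial meshes of $\Omega$, not fitted to $\Gamma$: $\Omega$ is divided into rectangles/cuboids by a tensor-product grid; for $N=2$ each rectangle is split into two triangles by a diagonal, for $N=3$ each cuboid is split into six tetrahedra sharing a space diagonal (Kuhn subdivision), in the same manner in every cell. Elements are open; $\mathcal T_h^\Gamma=\{T\in\mathcal T_h:T\cap\Gamma\neq\emptyset\}$; $h=\max_T\mathrm{diam}(T)$ is smaller than a fixed threshold (so that the interface is resolved). $I_h$ is continuous piecewise linear nodal interpolation, $I_{h,T}$ linear nodal interpolation on $T$ (componentwise on vectors). $\Gamma_h=\{I_hd=0\}$, $\Omega_h^\pm=\{\pm I_hd>0\}$, $T_h^\pm=T\cap\Omega_h^\pm$, $\mu_h|_{\Omega_h^\pm}=\mu^\pm$. For $T\in\mathcal T_h^\Gamma$: $\Gamma_{h,T}=\Gamma_h\cap T$ (assumed nonempty), $\Gamma_{h,T}^{ext}$ is the hyperplane containing it, $\mathbf n_h$ is the unit normal to it pointing from $\Omega_h^-$ to $\Omega_h^+$, $\mathbf t_{1,h},\dots,\mathbf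 t_{N-1,h}$ are unit tangent vectors forming with $\mathbf n_h$ an orthonormal basis, $\mathbf x_T^*$ is a fixed point of $\Gamma_{h,T}$; $[v]_{\Gamma_{h,T}}$ is the value from $\Omega_h^+$ minus that from $\Omega_h^-$. Vertex values of functions discontinuous across $\Gamma_h$ at a vertex on $\Gamma_h$ are taken from the minus side. $\boldsymbol\epsilon(\mathbf v)=\frac12(\nabla\mathbf v+(\nabla\mathbf v)^T)$, $\sigma(\mu,\mathbf v,q)=2\mu\boldsymbol\epsilon(\mathbf v)-q\mathbb I$ (for any real $\mu$). $P_1(\cup T_h^\pm)$ is the set of functions on $T$ whose restrictions to $T_h^+$ and $T_h^-$ are polynomials of degree $\le1$, $\boldsymbol P_1(\cup T_h^\pm)=P_1(\cup T_h^\pm)^N$. $\widetilde{\boldsymbol P_1P_1}(T)$ is the set of $(\mathbf v,q)\in(\boldsymbol P_1(\cup T_h^\pm),P_1(\cup T_h^\pm))$ with $[\sigma(\mu_h,\mathbf v,q)\mathbf n_h]_{\Gamma_{h,T}}(\mathbf x_T^* )=\mathbf 0$, $[\mathbf v]_{\Gamma_{h,T}}=\mathbf 0$, $[\nabla\cdot\mathbf v]_{\Gamma_{h,T}}=0$, $[\nabla q]_{\Gamma_{h,T}}=\mathbf 0$. The functions $z_T,w_T$ on $T$: $z_T=-1$ on $T_h^+$, $z_T=0$ on $T_h^-$; $w_T(\mathbf x)=\mathrm{dist}(\mathbf x,\Gamma_{h,T}^{ext})$ on $T_h^+$, $w_T=0$ on $T_h^-$. *)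

theory Defs
  imports "HOL-Analysis.Analysis"
begin

section \<open>Domain, interface and signed distance\<close>

definition C2_hypersurface :: "(real^'n) set \<Rightarrow> bool" where
  "C2_hypersurface \<Gamma> \<longleftrightarrow>
     (\<forall>p\<in>\<Gamma>. \<exists>U \<phi> (g :: real^'n \<Rightarrow> real^'n) (H :: real^'n \<Rightarrow> real^'n^'n).
        open U \<and> p \<in> U \<and>
        (\<forall>x\<in>U. GDERIV \<phi> x :> g x \<and> (g has_derivative (\<lambda>v. H x *v v)) (at x)) \<and>
        continuous_on U H \<and> (\<forall>x\<in>U. g x \<noteq> 0) \<and>
        \<Gamma> \<inter> U = {x\<in>U. \<phi> x = 0})"

text \<open>
  \<open>\<Omega>m\<close> is the inclusion. The condition on the boundary of \<open>\<Omega>p\<close> says that every part of the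
  interface really separates the two subdomains.
\<close>
definition interface_problem ::
    "(real^'n) set \<Rightarrow> (real^'n) set \<Rightarrow> (real^'n) set \<Rightarrow> (real^'n) set \<Rightarrow> bool" where
  "interface_problem \<Omega> \<Gamma> \<Omega>m \<Omega>p \<longleftrightarrow>
     (\<exists>lo hi. (\<forall>i. lo $ i < hi $ i) \<and> \<Omega> = box lo hi) \<and>
     \<Gamma> \<noteq> {} \<and> compact \<Gamma> \<and> C2_hypersurface \<Gamma> \<and> \<Gamma> \<subseteq> \<Omega> \<and>
     open \<Omega>m \<and> open \<Omega>p \<and> \<Omega> - \<Gamma> = \<Omega>m \<union> \<Omega>p \<and> \<Omega>m \<inter> \<Omega>p = {} \<and>
     frontier \<Omega>m = \<Gamma> \<and> frontier \<Omega>p = \<Gamma> \<union> frontier \<Omega>"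

text \<open>
  The positive sign is used everywhere outside \<open>\<Omega>m\<close>, which extends the signed distance
  continuously to the mesh vertices on the boundary of \<open>\<Omega>\<close>.
\<close>
definition signed_dist :: "(real^'n) set \<Rightarrow> (real^'n) set \<Rightarrow> real^'n \<Rightarrow> real" where
  "signed_dist \<Gamma> \<Omega>m x = (if x \<in> \<Omega>m then - infdist x \<Gamma> else infdist x \<Gamma>)"

section \<open>Cartesian simplicial meshes\<close>

definition consecutive :: "real set \<Rightarrow> real \<Rightarrow> real \<Rightarrow> bool" where
  "consecutive P s t \<longleftrightarrow> s \<in> P \<and> t \<in> P \<and> s < t \<and> P \<inter> {s<..<t} = {}"

definition grid_cells :: "('n \<Rightarrow> real set) \<Rightarrow> ((real^'n) \<times> (real^'n)) set" where
  "grid_cells G = {(l, u). \<forall>i. consecutive (G i) (l $ i) (u $ i)}"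

text \<open>
  The splitting diagonal of the cell \<open>cbox l u\<close> runs from the corner whose \<open>j\<close>-th coordinate is
  \<open>u $ j\<close> for \<open>j \<in> D\<close> and \<open>l $ j\<close> otherwise to the opposite corner. A Kuhn simplex is spanned by
  the corners met when walking from one end to the other along the coordinate directions in
  the order \<open>\<pi> 0, \<pi> 1, \<dots>\<close>; \<open>cell_corner D l u I\<close> is the corner reached after the moves in \<open>I\<close>.
  In two dimensions these are the two triangles cut off by the diagonal.
\<close>
definition cell_corner :: "'n set \<Rightarrow> real^'n \<Rightarrow> real^'n \<Rightarrow> 'n set \<Rightarrow> real^'n" where
  "cell_corner D l u I = (\<chi> j. if (j \<in> D) = (j \<in> I) then l $ j else u $ j)"

definition kuhn_simplex ::
    "'n set \<Rightarrow> real^'n \<Rightarrow> real^'n \<Rightarrow> (nat \<Rightarrow> 'n::finite) \<Rightarrow> (real^'n) set" where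
  "kuhn_simplex D l u \<pi> = (\<lambda>k. cell_corner D l u (\<pi> ` {..<k})) ` {..CARD('n)}"

text \<open>
  A mesh is the set of the vertex sets of its elements; the element with vertex set \<open>V\<close> is
  \<open>open_simplex V\<close>.
\<close>
definition kuhn_mesh :: "('n \<Rightarrow> real set) \<Rightarrow> 'n::finite set \<Rightarrow> (real^'n) set set" where
  "kuhn_mesh G D = {kuhn_simplex D l u \<pi> | l u \<pi>.
     (l, u) \<in> grid_cells G \<and> bij_betw \<pi> {..<CARD('n)} UNIV}"

definition open_simplex :: "(real^'n) set \<Rightarrow> (real^'n) set" where
  "open_simplex V = interior (convex hull V)"

definition cartesian_mesh :: "(real^'n::finite) set \<Rightarrow> (real^'n) set set \<Rightarrow> bool" where
  "cartesian_mesh \<Omega> M \<longleftrightarrow>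
     (\<exists>lo hi G D. (\<forall>i. lo $ i < hi $ i) \<and> \<Omega> = box lo hi \<and>
        (\<forall>i. finite (G i) \<and> {lo $ i, hi $ i} \<subseteq> G i \<and> G i \<subseteq> {lo $ i..hi $ i}) \<and>
        M = kuhn_mesh G D)"

definition mesh_size :: "(real^'n) set set \<Rightarrow> real" where
  "mesh_size M = Max ((\<lambda>V. diameter (open_simplex V)) ` M)"

definition shape_regular :: "(real^'n) set set set \<Rightarrow> bool" where
  "shape_regular \<F> \<longleftrightarrow>
     (\<exists>\<rho>. \<forall>M\<in>\<F>. \<forall>V\<in>M. \<exists>x r. 0 < r \<and> ball x r \<subseteq> open_simplex V \<and>
        diameter (open_simplex V) \<le> \<rho> * r)"

definition interface_elements :: "(real^'n) set set \<Rightarrow> (real^'n) set \<Rightarrow> (real^'n) set set" where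
  "interface_elements M \<Gamma> = {V\<in>M. open_simplex V \<inter> \<Gamma> \<noteq> {}}"

section \<open>Nodal interpolation and the discrete interface\<close>

text \<open>Polynomials of degree at most one, componentwise if vector-valued.\<close>
definition P1 :: "('a::real_vector \<Rightarrow> 'b::real_vector) set" where
  "P1 = {p. \<exists>A b. linear A \<and> p = (\<lambda>x. A x + b)}"

text \<open>The interpolant on a simplex is regarded as a polynomial on the whole space.\<close>
definition lin_interp :: "'a::real_vector set \<Rightarrow> ('a \<Rightarrow> 'b::real_vector) \<Rightarrow> 'a \<Rightarrow> 'b" where
  "lin_interp V f = (THE p. p \<in> P1 \<and> (\<forall>a\<in>V. p a = f a))"

text \<open>The value does not depend on the chosen closed element, since the meshes are conforming.\<close>
definition mesh_interp :: "(real^'n) set set \<Rightarrow> (real^'n \<Rightarrow> real) \<Rightarrow> real^'n \<Rightarrow> real" where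
  "mesh_interp M f x = lin_interp (SOME V. V \<in> M \<and> x \<in> convex hull V) f x"

definition discrete_interface ::
    "(real^'n) set \<Rightarrow> (real^'n) set set \<Rightarrow> (real^'n \<Rightarrow> real) \<Rightarrow> (real^'n) set" where
  "discrete_interface \<Omega> M d = {x\<in>\<Omega>. mesh_interp M d x = 0}"

definition discrete_plus ::
    "(real^'n) set \<Rightarrow> (real^'n) set set \<Rightarrow> (real^'n \<Rightarrow> real) \<Rightarrow> (real^'n) set" where
  "discrete_plus \<Omega> M d = {x\<in>\<Omega>. mesh_interp M d x > 0}"

definition discrete_minus ::
    "(real^'n) set \<Rightarrow> (real^'n) set set \<Rightarrow> (real^'n \<Rightarrow> real) \<Rightarrow> (real^'n) set" where
  "discrete_minus \<Omega> M d = {x\<in>\<Omega>. mesh_interp M d x < 0}"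

definition hyperplane :: "(real^'n) set \<Rightarrow> bool" where
  "hyperplane S \<longleftrightarrow> (\<exists>a b. a \<noteq> 0 \<and> S = {x. a \<bullet> x = b})"

text \<open>
  What small mesh size is needed for: on an interface element the discrete interface is a piece
  of a hyperplane, i.e. the interpolated signed distance does not vanish identically there.
\<close>
definition resolves_interface ::
    "(real^'n) set \<Rightarrow> (real^'n) set \<Rightarrow> (real^'n) set set \<Rightarrow> (real^'n \<Rightarrow> real) \<Rightarrow> bool" where
  "resolves_interface \<Omega> \<Gamma> M d \<longleftrightarrow>
     (\<forall>V\<in>interface_elements M \<Gamma>.
        discrete_interface \<Omega> M d \<inter> open_simplex V \<noteq> {} \<longrightarrow>
        (\<exists>S. hyperplane S \<and> discrete_interface \<Omega> M d \<inter> open_simplex V \<subseteq> S))"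

text \<open>
  \<open>n\<close> is the unit normal of the hyperplane \<open>S\<close> containing the piece \<open>\<Gamma>T\<close> of the discrete
  interface, pointing from the discrete subdomain \<open>Om\<close> to \<open>Op\<close>.
\<close>
definition interface_normal ::
    "(real^'n) set \<Rightarrow> (real^'n) set \<Rightarrow> (real^'n) set \<Rightarrow> (real^'n) set \<Rightarrow> real^'n \<Rightarrow> bool" where
  "interface_normal Om Op \<Gamma>T S n \<longleftrightarrow>
     norm n = 1 \<and> (\<forall>x\<in>S. \<forall>y\<in>S. n \<bullet> (x - y) = 0) \<and>
     (\<forall>x\<in>\<Gamma>T. \<forall>\<^sub>F e in at_right 0. x + e *\<^sub>R n \<in> Op \<and> x - e *\<^sub>R n \<in> Om)"

section \<open>Differential operators\<close>

definition grad :: "(real^'n \<Rightarrow> real) \<Rightarrow> real^'n \<Rightarrow> real^'n" where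
  "grad f x = (\<chi> i. frechet_derivative f (at x) (axis i 1))"

definition divergence :: "(real^'n \<Rightarrow> real^'n) \<Rightarrow> real^'n \<Rightarrow> real" where
  "divergence v x = trace (jacobian v (at x))"

definition strain :: "(real^'n \<Rightarrow> real^'n) \<Rightarrow> real^'n \<Rightarrow> real^'n^'n" where
  "strain v x = (1/2) *\<^sub>R (jacobian v (at x) + transpose (jacobian v (at x)))"

definition stress ::
    "real \<Rightarrow> (real^'n \<Rightarrow> real^'n) \<Rightarrow> (real^'n \<Rightarrow> real) \<Rightarrow> real^'n \<Rightarrow> real^'n^'n" where
  "stress \<mu> v q x = (2 * \<mu>) *\<^sub>R strain v x - q x *\<^sub>R mat 1"

section \<open>The local immersed finite element space\<close>

text \<open>
  Functions on \<open>Tp \<union> Tm\<close>, the element without the discrete interface, which are polynomials of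
  degree at most one on each side. They are fixed (to be \<open>undefined\<close>) elsewhere, so that
  equality of functions means equality on \<open>Tp \<union> Tm\<close>.
\<close>
definition broken_P1 ::
    "(real^'n) set \<Rightarrow> (real^'n) set \<Rightarrow> (real^'n \<Rightarrow> 'b::real_vector) set" where
  "broken_P1 Tp Tm =
     {f \<in> extensional (Tp \<union> Tm). (\<exists>p\<in>P1. \<forall>x\<in>Tp. f x = p x) \<and> (\<exists>p\<in>P1. \<forall>x\<in>Tm. f x = p x)}"

text \<open>
  The polynomial that agrees with \<open>f\<close> on the open set \<open>A\<close>. It provides the one-sided traces on
  the discrete interface and the one-sided vertex values.
\<close>
definition poly_ext :: "(real^'n) set \<Rightarrow> (real^'n \<Rightarrow> 'b::real_vector) \<Rightarrow> real^'n \<Rightarrow> 'b" where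
  "poly_ext A f = (THE p. p \<in> P1 \<and> (\<forall>x\<in>A. f x = p x))"

text \<open>
  At a vertex \<open>a\<close> the interpolated signed distance equals \<open>d a\<close>, so the sign of \<open>d a\<close> tells on
  which side of the discrete interface the vertex lies; vertices on it take the value from the
  minus side.
\<close>
definition vertex_value ::
    "(real^'n \<Rightarrow> real) \<Rightarrow> (real^'n) set \<Rightarrow> (real^'n) set \<Rightarrow>
     (real^'n \<Rightarrow> 'b::real_vector) \<Rightarrow> real^'n \<Rightarrow> 'b" where
  "vertex_value d Tp Tm f a = (if d a > 0 then poly_ext Tp f a else poly_ext Tm f a)"

definition IFE_space ::
    "real \<Rightarrow> real \<Rightarrow> (real^'n) set \<Rightarrow> (real^'n) set \<Rightarrow> (real^'n) set \<Rightarrow> real^'n \<Rightarrow> real^'n \<Rightarrow>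
     ((real^'n \<Rightarrow> real^'n) \<times> (real^'n \<Rightarrow> real)) set" where
  "IFE_space \<mu>p \<mu>m Tp Tm \<Gamma>T xT n =
     {(v, q). v \<in> broken_P1 Tp Tm \<and> q \<in> broken_P1 Tp Tm \<and>
        stress \<mu>p (poly_ext Tp v) (poly_ext Tp q) xT *v n
          - stress \<mu>m (poly_ext Tm v) (poly_ext Tm q) xT *v n = 0 \<and>
        (\<forall>x\<in>\<Gamma>T. poly_ext Tp v x - poly_ext Tm v x = 0) \<and>
        (\<forall>x\<in>\<Gamma>T. divergence (poly_ext Tp v) x - divergence (poly_ext Tm v) x = 0) \<and>
        (\<forall>x\<in>\<Gamma>T. grad (poly_ext Tp q) x - grad (poly_ext Tm q) x = 0)}"

definition z_fun :: "(real^'n) set \<Rightarrow> real^'n \<Rightarrow> real" where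
  "z_fun Tp x = (if x \<in> Tp then -1 else 0)"

definition w_fun :: "(real^'n) set \<Rightarrow> (real^'n) set \<Rightarrow> real^'n \<Rightarrow> real" where
  "w_fun Tp S x = (if x \<in> Tp then infdist x S else 0)"

end

theory Submission
  imports Defs
begin

text \<open>
  Write \<open>s\<close> for the signed height above the hyperplane containing the discrete interface. The
  two pieces of a velocity in the local space differ by \<open>s\<close> times a vector \<open>a\<close>, and those of a
  pressure by a constant \<open>\<delta>\<close>; the divergence condition says that \<open>a\<close> is tangential. Hence
  \<open>v = Iv + (w - Iw) a\<close> and \<open>q = Iq - \<delta> (z - Iz)\<close>, and the stress condition becomes
  \<open>(\<mu>p + (\<mu>m - \<mu>p) \<theta>) a + 2 (\<mu>p - \<mu>m) \<epsilon>(Iv) n = \<delta> n\<close> with \<open>\<theta> = \<nabla>Iw \<bullet> n\<close>. Its normal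
  component gives \<open>\<delta>\<close>. Its tangential components give \<open>a\<close>, provided that the scalar factor does not
  vanish, and this holds since \<open>0 \<le> \<theta> \<le> 1\<close>: a Kuhn simplex has an edge in every coordinate
  direction, along which the divided difference of the positive part of \<open>s\<close> lies between \<open>0\<close> and
  that of \<open>s\<close>.
\<close>

section \<open>Affine functions\<close>

lemma P1_I: "linear A \<Longrightarrow> (\<lambda>x. A x + b) \<in> P1"
  unfolding P1_def by blast

lemma P1_E:
  assumes "p \<in> P1"
  obtains A b where "linear A" "p = (\<lambda>x. A x + b)"
  using assms unfolding P1_def by blast

lemma P1_const: "(\<lambda>x. b) \<in> P1"
  using P1_I[OF linear_zero, of b] by simp

lemma P1_add:
  assumes "p \<in> P1" "q \<in> P1"
  shows "(\<lambda>x. p x + q x) \<in> P1"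
proof -
  obtain A b where A: "linear A" "p = (\<lambda>x. A x + b)" using assms(1) by (rule P1_E)
  obtain B c where B: "linear B" "q = (\<lambda>x. B x + c)" using assms(2) by (rule P1_E)
  have "(\<lambda>x. (A x + B x) + (b + c)) \<in> P1"
    by (rule P1_I[OF linear_compose_add[OF A(1) B(1)]])
  then show ?thesis by (simp add: A B algebra_simps)
qed

lemma P1_scaleR:
  fixes p :: "'a::real_vector \<Rightarrow> real"
  assumes "p \<in> P1"
  shows "(\<lambda>x. p x *\<^sub>R a) \<in> P1"
proof -
  obtain A b where A: "linear A" "p = (\<lambda>x. A x + b)" using assms by (rule P1_E)
  have "linear (\<lambda>x. A x *\<^sub>R a)"
    using A(1) by (simp add: linear_iff scaleR_add_left)
  from P1_I[OF this, of "b *\<^sub>R a"] show ?thesis by (simp add: A scaleR_add_left)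
qed

lemma P1_diff:
  assumes "p \<in> P1" "q \<in> P1"
  shows "(\<lambda>x. p x - q x) \<in> P1"
proof -
  obtain A b where A: "linear A" "p = (\<lambda>x. A x + b)" using assms(1) by (rule P1_E)
  obtain B c where B: "linear B" "q = (\<lambda>x. B x + c)" using assms(2) by (rule P1_E)
  have "(\<lambda>x. (A x - B x) + (b - c)) \<in> P1"
    by (rule P1_I[OF linear_compose_sub[OF A(1) B(1)]])
  then show ?thesis by (simp add: A B algebra_simps)
qed

lemma P1_inner: "(\<lambda>x. n \<bullet> (x - y)) \<in> P1" for n y :: "'a::real_inner"
  using P1_I[of "(\<bullet>) n" "- (n \<bullet> y)"]
  by (simp add: inner_diff_right bounded_linear.linear bounded_linear_inner_right)

section \<open>Affine functions are determined by their values near a point\<close>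

lemma open_small_step:
  fixes x v :: "'a::real_normed_vector"
  assumes "open T" "x \<in> T"
  shows "\<forall>\<^sub>F e in at_right 0. x + e *\<^sub>R v \<in> T"
proof -
  have "((\<lambda>e. x + e *\<^sub>R v) \<longlongrightarrow> x + 0 *\<^sub>R v) (at_right 0)"
    by (intro tendsto_intros)
  then show ?thesis
    using topological_tendstoD[OF _ assms(1)] assms(2) by simp
qed

lemma open_small_stepE:
  fixes x v :: "'a::real_normed_vector"
  assumes "open T" "x \<in> T"
  obtains e where "e > 0" "x + e *\<^sub>R v \<in> T"
proof -
  have "\<forall>\<^sub>F e in at_right (0::real). e > 0 \<and> x + e *\<^sub>R v \<in> T"
    using open_small_step[OF assms] eventually_at_right_less by eventually_elim auto
  from eventually_happens[OF this] show ?thesis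
    using that by auto
qed

text \<open>A small step from \<open>y\<close> in any direction orthogonal to \<open>n\<close> stays
  in the slice of \<open>T\<close>, so \<open>A\<close> kills all these directions and only the
  normal component of \<open>x - y\<close> contributes.\<close>

lemma affine_vanishing_on_slice:
  fixes A :: "'a::real_inner \<Rightarrow> 'b::real_vector"
  assumes A: "linear A" and T: "open T" "y \<in> T" and n: "norm n = 1"
    and vanish: "\<forall>x\<in>T. n \<bullet> (x - y) = 0 \<longrightarrow> A x + b = 0"
  shows "A x + b = (n \<bullet> (x - y)) *\<^sub>R A n"
proof -
  interpret A: linear A by (rule A)
  have nn: "n \<bullet> n = 1" using n by (simp add: norm_eq_1)
  define v where "v = x - y - (n \<bullet> (x - y)) *\<^sub>R n"
  have v: "n \<bullet> v = 0" by (simp add: v_def inner_diff_right nn)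
  obtain e where e: "e > 0" "y + e *\<^sub>R v \<in> T"
    using open_small_stepE[OF T] by blast
  have y0: "A y + b = 0" using vanish T by simp
  have "A (y + e *\<^sub>R v) + b = 0" using vanish e v by simp
  moreover have "A (y + e *\<^sub>R v) + b = (A y + b) + e *\<^sub>R A v"
    by (simp add: A.add A.scaleR)
  ultimately have "e *\<^sub>R A v = 0" using y0 by simp
  then have "A v = 0" using e by simp
  moreover have "A v = A x - A y - (n \<bullet> (x - y)) *\<^sub>R A n"
    by (simp add: v_def A.diff A.scaleR)
  ultimately show ?thesis using y0 by (simp add: algebra_simps)
qed

text \<open>From a point of \<open>A\<close>, a small positive multiple of every direction stays in
  \<open>A\<close>, which forces the linear part of the difference to vanish. Hence
  \<open>poly_ext\<close> describes at most one polynomial.\<close>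

lemma P1_eq_open:
  fixes p q :: "'a::real_normed_vector \<Rightarrow> 'b::real_vector"
  assumes "p \<in> P1" "q \<in> P1" and A: "open A" "A \<noteq> {}" and eq: "\<forall>x\<in>A. p x = q x"
  shows "p = q"
proof
  fix x
  obtain L b where L: "linear L" "(\<lambda>x. p x - q x) = (\<lambda>x. L x + b)"
    using P1_diff[OF assms(1,2)] by (rule P1_E)
  interpret L: linear L by (rule L)
  have pq: "p x - q x = L x + b" for x using fun_cong[OF L(2)] .
  obtain y where y: "y \<in> A" using A by blast
  obtain e where e: "e > 0" "y + e *\<^sub>R (x - y) \<in> A"
    using open_small_stepE[OF A(1) y] by blast
  have "L y + b = 0" using eq y pq[of y] by simp
  moreover have "L (y + e *\<^sub>R (x - y)) + b = 0" using eq e(2) pq[of "y + e *\<^sub>R (x - y)"] by simp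
  moreover have "L (y + e *\<^sub>R (x - y)) + b = (L y + b) + e *\<^sub>R (L x - L y)"
    by (simp add: L.add L.scaleR L.diff)
  ultimately have "e *\<^sub>R (L x - L y) = 0" by simp
  then have "L x = L y" using e by simp
  then show "p x = q x" using pq[of x] \<open>L y + b = 0\<close> by simp
qed

section \<open>One-sided polynomials and nodal interpolants\<close>

lemma poly_ext_eqI:
  fixes f :: "real^'n \<Rightarrow> 'b::real_vector"
  assumes "open A" "A \<noteq> {}" "p \<in> P1" "\<And>x. x \<in> A \<Longrightarrow> f x = p x"
  shows "poly_ext A f = p"
  unfolding poly_ext_def
proof (rule the_equality)
  show "p \<in> P1 \<and> (\<forall>x\<in>A. f x = p x)" using assms by blast
next
  fix q assume q: "q \<in> P1 \<and> (\<forall>x\<in>A. f x = q x)"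
  then have "\<forall>x\<in>A. q x = p x" by (metis assms(4))
  then show "q = p" using P1_eq_open[of q p A] assms(1-3) q by blast
qed

text \<open>The zero set of the difference is an affine set, so with \<open>V\<close> it contains
  the affine hull of \<open>V\<close>.\<close>

lemma P1_eq_affine_hull:
  assumes "p \<in> P1" "q \<in> P1" and hull: "affine hull V = UNIV" and eq: "\<forall>a\<in>V. p a = q a"
  shows "p = q"
proof
  fix x
  obtain L b where L: "linear L" "(\<lambda>x. p x - q x) = (\<lambda>x. L x + b)"
    using P1_diff[OF assms(1,2)] by (rule P1_E)
  interpret L: linear L by (rule L)
  have pq: "p x - q x = L x + b" for x using fun_cong[OF L(2)] .
  have "affine {x. L x + b = 0}"
    unfolding affine_def
  proof (clarsimp simp: L.add L.scaleR)
    fix x y and u v :: real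
    assume "L x + b = 0" "L y + b = 0" "u + v = 1"
    then have "u *\<^sub>R L x + v *\<^sub>R L y + b = u *\<^sub>R (- b) + v *\<^sub>R (- b) + b"
      by (metis eq_neg_iff_add_eq_0)
    also have "\<dots> = b - (u + v) *\<^sub>R b" by (simp add: scaleR_add_left)
    also have "\<dots> = 0" using \<open>u + v = 1\<close> by simp
    finally show "u *\<^sub>R L x + v *\<^sub>R L y + b = 0" .
  qed
  moreover have "V \<subseteq> {x. L x + b = 0}" using eq by (auto simp flip: pq)
  ultimately have "affine hull V \<subseteq> {x. L x + b = 0}" by (simp add: hull_minimal)
  then have "L x + b = 0" using hull by blast
  then show "p x = q x" using pq[of x] by simp
qed

lemma lin_interp_eqI:
  assumes "affine hull V = UNIV" "p \<in> P1" "\<And>a. a \<in> V \<Longrightarrow> p a = f a"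
  shows "lin_interp V f = p"
  unfolding lin_interp_def
proof (rule the_equality)
  show "p \<in> P1 \<and> (\<forall>a\<in>V. p a = f a)" using assms by blast
next
  fix q assume "q \<in> P1 \<and> (\<forall>a\<in>V. q a = f a)"
  then show "q = p" using P1_eq_affine_hull[of q p V] assms by simp
qed

text \<open>Moving one vertex to the origin turns affine independence into linear independence of
  the others, and values prescribed on an independent set extend to a linear map.\<close>

lemma lin_interp_works:
  assumes indep: "\<not> affine_dependent V" and hull: "affine hull V = UNIV"
  shows lin_interp_P1: "lin_interp V f \<in> P1"
    and lin_interp_vertex: "a \<in> V \<Longrightarrow> lin_interp V f a = f a"
proof -
  have "V \<noteq> {}" using hull by auto
  then obtain x0 where x0: "x0 \<in> V" by blast
  have ind: "independent ((\<lambda>x. - x0 + x) ` (V - {x0}))"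
    using affine_dependent_iff_dependent2[OF x0] indep by blast
  obtain g where g: "linear g" "\<forall>x\<in>(\<lambda>x. - x0 + x) ` (V - {x0}). g x = f (x0 + x) - f x0"
    using linear_independent_extend[OF ind, of "\<lambda>x. f (x0 + x) - f x0"] by blast
  interpret g: linear g by (rule g)
  define p where "p = (\<lambda>x. g x + (f x0 - g x0))"
  have p: "p \<in> P1" unfolding p_def by (rule P1_I[OF g(1)])
  have pv: "p x = f x" if "x \<in> V" for x
  proof (cases "x = x0")
    case False
    then have "g (- x0 + x) = f (x0 + (- x0 + x)) - f x0" using g(2) that by blast
    then show ?thesis by (simp add: p_def g.diff algebra_simps)
  qed (simp add: p_def)
  have "lin_interp V f = p" using lin_interp_eqI[OF hull p] pv by blast
  then show "lin_interp V f \<in> P1" "a \<in> V \<Longrightarrow> lin_interp V f a = f a"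
    using p pv by blast+
qed

section \<open>Differential operators applied to affine functions\<close>

lemma frechet_derivative_P1:
  fixes A :: "'a::euclidean_space \<Rightarrow> 'b::real_normed_vector"
  assumes "linear A"
  shows "frechet_derivative (\<lambda>x. A x + b) (at x) = A"
proof -
  have "bounded_linear A" using assms by (simp add: linear_conv_bounded_linear)
  then have "((\<lambda>x. A x + b) has_derivative A) (at x)"
    by (auto intro!: derivative_eq_intros bounded_linear_imp_has_derivative)
  then show ?thesis by (metis frechet_derivative_at)
qed

lemma grad_P1:
  assumes "linear A"
  shows "grad (\<lambda>x. A x + b) x \<bullet> y = A y"
proof -
  interpret linear A by (rule assms)
  have "A y = A (\<Sum>i\<in>UNIV. (y $ i) *\<^sub>R axis i 1)"
    using basis_expansion[of y] by (simp add: scalar_mult_eq_scaleR)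
  also have "\<dots> = (\<Sum>i\<in>UNIV. y $ i * A (axis i 1))"
    by (simp add: sum scaleR)
  finally show ?thesis
    by (simp add: grad_def frechet_derivative_P1[OF assms] inner_vec_def mult.commute)
qed

text \<open>The adjoint replaces the transposed matrix, so that the stress balance can be computed
  with linear maps evaluated at the normal.\<close>

lemma strain_P1:
  fixes A :: "real^'n \<Rightarrow> real^'n"
  assumes "linear A"
  shows "strain (\<lambda>x. A x + b) x *v y = (1/2) *\<^sub>R (A y + adjoint A y)"
proof -
  have mat: "matrix A *v x = A x" for x
    using matrix_works[of A] assms by (simp add: scalar_mult_eq_scaleR[abs_def])
  then have "adjoint A y = transpose (matrix A) *v y"
    using adjoint_matrix[of "matrix A"] by simp
  then show ?thesis
    by (simp add: strain_def jacobian_def frechet_derivative_P1[OF assms]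
        matrix_vector_mult_add_rdistrib mat scaleR_matrix_vector_assoc[symmetric])
qed

lemma stress_P1:
  fixes A :: "real^'n \<Rightarrow> real^'n"
  assumes "linear A"
  shows "stress \<mu> (\<lambda>x. A x + b) q x *v y = \<mu> *\<^sub>R (A y + adjoint A y) - q x *\<^sub>R y"
  by (simp add: stress_def strain_P1[OF assms] matrix_vector_mult_diff_rdistrib
      scaleR_matrix_vector_assoc[symmetric])

lemma divergence_P1:
  fixes A :: "real^'n \<Rightarrow> real^'n"
  assumes "linear A"
  shows "divergence (\<lambda>x. A x + b) x = (\<Sum>i\<in>UNIV. A (axis i 1) $ i)"
  by (simp add: divergence_def jacobian_def frechet_derivative_P1[OF assms] trace_def matrix_def)

text \<open>The adjoint of the rank-one term sends \<open>y\<close> to a multiple of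
  \<open>a \<bullet> y\<close>. With \<open>y\<close> the normal and \<open>a\<close> tangential,
  only one half of the symmetrised jump of the gradient survives.\<close>

lemma adjoint_add_rank_one:
  fixes A :: "real^'n \<Rightarrow> real^'n" and W :: "real^'n \<Rightarrow> real"
  assumes "linear A" "linear W" "a \<bullet> y = 0"
  shows "adjoint (\<lambda>x. A x + W x *\<^sub>R a) y = adjoint A y"
proof -
  have lin: "linear (\<lambda>x. A x + W x *\<^sub>R a)"
    using assms by (intro linear_compose_add) (simp_all add: linear_iff scaleR_add_left)
  have "x \<bullet> adjoint (\<lambda>x. A x + W x *\<^sub>R a) y = x \<bullet> adjoint A y" for x
    using assms by (simp add: adjoint_works[OF lin] adjoint_works inner_add_left)
  then show ?thesis by (metis vector_eq_ldot)
qed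

section \<open>Kuhn simplices\<close>

lemma interior_halfspace_strict:
  fixes a :: "'a::euclidean_space"
  assumes "a \<noteq> 0" "T \<subseteq> {x. a \<bullet> x \<ge> b}" "x \<in> interior T"
  shows "a \<bullet> x > b"
  using interior_mono[OF assms(2)] interior_halfspace_ge[OF assms(1), of b] assms(3) by blast

text \<open>
  Affine coordinates in which the corner reached after the moves in \<open>I\<close> is the indicator of \<open>I\<close>; the
  Kuhn simplex of \<open>\<pi>\<close> is then the set where the coordinates decrease along \<open>\<pi>\<close>.
\<close>
definition cell_coord :: "'n set \<Rightarrow> real^'n \<Rightarrow> real^'n \<Rightarrow> 'n \<Rightarrow> real^'n \<Rightarrow> real" where
  "cell_coord D l u j x =
     (if j \<in> D then (u $ j - x $ j) / (u $ j - l $ j) else (x $ j - l $ j) / (u $ j - l $ j))"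

lemma cell_coord_corner:
  assumes "l $ j < u $ j"
  shows "cell_coord D l u j (cell_corner D l u I) = (if j \<in> I then 1 else 0)"
  using assms by (auto simp: cell_coord_def cell_corner_def)

text \<open>Different coordinates depend on different components of \<open>x\<close>, so
  \<open>g\<close> cannot vanish. Comparing two coordinates therefore describes a genuine
  half-space, whose interior is given by the strict inequality.\<close>

lemma cell_coord_diff_inner:
  fixes l u :: "real^'n"
  assumes "\<forall>j. l $ j < u $ j" "a \<noteq> b"
  obtains g c where "g \<noteq> 0" "\<And>x. cell_coord D l u a x - cell_coord D l u b x = g \<bullet> x - c"
proof -
  define k where "k j = (if j \<in> D then - 1 else 1) / (u $ j - l $ j)" for j
  define e where "e j = (if j \<in> D then u $ j else - (l $ j)) / (u $ j - l $ j)" for j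
  have kj: "cell_coord D l u j x = k j * x $ j + e j" for j x
    by (simp add: cell_coord_def k_def e_def diff_divide_distrib)
  define g where "g = k a *\<^sub>R axis a 1 - k b *\<^sub>R (axis b 1 :: real^'n)"
  have "g $ a = k a" using assms(2) by (simp add: g_def axis_def)
  moreover have "k a \<noteq> 0" using assms(1)[rule_format, of a] by (simp add: k_def)
  ultimately have "g \<noteq> 0" by auto
  moreover have "cell_coord D l u a x - cell_coord D l u b x = g \<bullet> x - (e b - e a)" for x
    by (simp add: kj g_def inner_diff_left inner_axis')
  ultimately show ?thesis using that by blast
qed

text \<open>A corner at which the move \<open>\<pi> j\<close> has been made has the earlier move
  \<open>\<pi> i\<close> behind it as well. So all vertices, and with them the hull, lie in one
  closed half-space, and interior points lie in the open one.\<close>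

lemma kuhn_simplex_coord_le:
  assumes lu: "\<forall>j. l $ j < u $ j" and \<pi>: "bij_betw \<pi> {..<CARD('n::finite)} UNIV"
    and ij: "i < j" "j < CARD('n)"
  shows kuhn_simplex_coord_mono:
      "x \<in> convex hull (kuhn_simplex D l u \<pi>) \<Longrightarrow>
        cell_coord D l u (\<pi> j) x \<le> cell_coord D l u (\<pi> i) (x :: real^'n)"
    and kuhn_simplex_coord_strict:
      "x \<in> open_simplex (kuhn_simplex D l u \<pi>) \<Longrightarrow>
        cell_coord D l u (\<pi> j) x < cell_coord D l u (\<pi> i) x"
proof -
  have inj: "inj_on \<pi> {..<CARD('n)}" using \<pi> by (simp add: bij_betw_def)
  have "\<pi> i \<noteq> \<pi> j" using inj ij by (auto simp: inj_on_def)
  then obtain g c where g: "g \<noteq> 0"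
    "\<And>x. cell_coord D l u (\<pi> i) x - cell_coord D l u (\<pi> j) x = g \<bullet> x - c"
    using cell_coord_diff_inner[OF lu] by metis
  have "kuhn_simplex D l u \<pi> \<subseteq> {x. g \<bullet> x \<ge> c}"
  proof
    fix x assume "x \<in> kuhn_simplex D l u \<pi>"
    then obtain k where k: "k \<le> CARD('n)" "x = cell_corner D l u (\<pi> ` {..<k})"
      by (auto simp: kuhn_simplex_def)
    have "\<pi> m \<in> \<pi> ` {..<k} \<longleftrightarrow> m < k" if "m < CARD('n)" for m
      using inj_on_image_mem_iff[OF inj, of m "{..<k}"] that k by auto
    then have "\<pi> j \<in> \<pi> ` {..<k} \<Longrightarrow> \<pi> i \<in> \<pi> ` {..<k}"
      using ij by simp
    then have "cell_coord D l u (\<pi> j) x \<le> cell_coord D l u (\<pi> i) x"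
      by (simp add: k cell_coord_corner lu)
    then show "x \<in> {x. g \<bullet> x \<ge> c}" using g(2)[of x] by simp
  qed
  then have hull: "convex hull (kuhn_simplex D l u \<pi>) \<subseteq> {x. g \<bullet> x \<ge> c}"
    by (simp add: hull_minimal convex_halfspace_ge)
  show "cell_coord D l u (\<pi> j) x \<le> cell_coord D l u (\<pi> i) x"
    if "x \<in> convex hull (kuhn_simplex D l u \<pi>)"
    using hull that g(2)[of x] by force
  show "cell_coord D l u (\<pi> j) x < cell_coord D l u (\<pi> i) x"
    if "x \<in> open_simplex (kuhn_simplex D l u \<pi>)"
    using interior_halfspace_strict[OF g(1) hull] that g(2)[of x] by (force simp: open_simplex_def)
qed

section \<open>Elements of a Kuhn mesh do not overlap\<close>

lemma kuhn_simplex_subset_cell: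
  assumes "\<forall>j. l $ j < u $ j"
  shows "convex hull (kuhn_simplex D l u \<pi>) \<subseteq> cbox l (u :: real^'n::finite)"
proof -
  have "cell_corner D l u I \<in> cbox l u" for I
    using assms by (auto simp: cell_corner_def mem_box_cart less_imp_le)
  then have "kuhn_simplex D l u \<pi> \<subseteq> cbox l u" by (auto simp: kuhn_simplex_def)
  then show ?thesis by (simp add: hull_minimal convex_box)
qed

text \<open>The endpoints are grid points, and neither interval has a grid point strictly
  inside.\<close>

lemma consecutive_unique:
  assumes "consecutive P s t" "consecutive P s' t'" "s < x" "x < t" "s' \<le> x" "x \<le> t'"
  shows "s' = s" "t' = t"
proof -
  have dich: "r \<le> s \<or> t \<le> r" if "r \<in> P" for r
    using assms(1) that by (force simp: consecutive_def)
  have dich': "r \<le> s' \<or> t' \<le> r" if "r \<in> P" for r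
    using assms(2) that by (force simp: consecutive_def)
  have P: "s \<in> P" "t \<in> P" "s' \<in> P" "t' \<in> P" "s < t" "s' < t'"
    using assms by (auto simp: consecutive_def)
  show "s' = s" "t' = t"
    using dich[OF P(3)] dich[OF P(4)] dich'[OF P(1)] dich'[OF P(2)] P(5,6) assms(3-6) by linarith+
qed

text \<open>An interior point fixes the cell, and the strict order of its coordinates fixes the
  order of the moves. Hence the choice in \<open>mesh_interp\<close> has a single candidate at
  points of an open element.\<close>

lemma kuhn_mesh_element_unique:
  fixes x :: "real^'n::finite"
  assumes V: "V \<in> kuhn_mesh G D" and V': "V' \<in> kuhn_mesh G D"
    and x: "x \<in> open_simplex V" and x': "x \<in> convex hull V'"
  shows "V' = V"
proof -
  obtain l u \<pi> where 1: "V = kuhn_simplex D l u \<pi>" "(l, u) \<in> grid_cells G"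
    "bij_betw \<pi> {..<CARD('n)} UNIV" using V by (auto simp: kuhn_mesh_def)
  obtain l' u' \<pi>' where 2: "V' = kuhn_simplex D l' u' \<pi>'" "(l', u') \<in> grid_cells G"
    "bij_betw \<pi>' {..<CARD('n)} UNIV" using V' by (auto simp: kuhn_mesh_def)
  have c: "consecutive (G i) (l $ i) (u $ i)" "consecutive (G i) (l' $ i) (u' $ i)" for i
    using 1 2 by (auto simp: grid_cells_def)
  then have lu: "\<forall>i. l $ i < u $ i" "\<forall>i. l' $ i < u' $ i" by (auto simp: consecutive_def)
  have "x \<in> box l u"
    using x interior_mono[OF kuhn_simplex_subset_cell[OF lu(1)]] by (auto simp: 1 open_simplex_def)
  moreover have "x \<in> cbox l' u'"
    using x' kuhn_simplex_subset_cell[OF lu(2)] by (auto simp: 2)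
  ultimately have "l $ i < x $ i" "x $ i < u $ i" "l' $ i \<le> x $ i" "x $ i \<le> u' $ i" for i
    by (simp_all add: mem_box_cart)
  from consecutive_unique[OF c this] have "l' $ i = l $ i" "u' $ i = u $ i" for i .
  then have eq: "l' = l" "u' = u" by (simp_all add: vec_eq_iff)
  let ?y = "\<lambda>j. cell_coord D l u j x"
  \<comment> \<open>The vertices depend on \<open>\<pi>\<close> only through these initial sets; the
    functions themselves may differ at indices from \<open>CARD('n)\<close> on.\<close>
  have "\<pi> ` {..<k} = \<pi>' ` {..<k}" if k: "k \<le> CARD('n)" for k
  proof (rule ccontr)
    assume ne: "\<pi> ` {..<k} \<noteq> \<pi>' ` {..<k}"
    have inj: "inj_on \<pi> {..<CARD('n)}" "inj_on \<pi>' {..<CARD('n)}"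
      using 1 2 by (auto simp: bij_betw_def)
    \<comment> \<open>Different sets of equal size each contain an element that the other lacks.
      These two moves come in opposite orders in \<open>\<pi>\<close> and \<open>\<pi>'\<close>,
      which gives a strict inequality against a weak one.\<close>
    have "card (\<pi> ` {..<k}) = k" "card (\<pi>' ` {..<k}) = k"
      using k inj by (auto simp: card_image inj_on_def)
    then have "\<not> \<pi> ` {..<k} \<subseteq> \<pi>' ` {..<k}" "\<not> \<pi>' ` {..<k} \<subseteq> \<pi> ` {..<k}"
      using ne by (metis card_subset_eq finite_imageI finite_lessThan)+
    then obtain a b where ab: "a \<in> \<pi> ` {..<k}" "a \<notin> \<pi>' ` {..<k}"
      "b \<in> \<pi>' ` {..<k}" "b \<notin> \<pi> ` {..<k}" by blast
    have surj: "\<pi> ` {..<CARD('n)} = UNIV" "\<pi>' ` {..<CARD('n)} = UNIV"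
      using 1 2 by (auto simp: bij_betw_def)
    obtain i where i: "a = \<pi> i" "i < k" using ab by auto
    obtain j where j: "b = \<pi> j" "j < CARD('n)" using surj by (metis UNIV_I image_iff lessThan_iff)
    have "\<not> j < k" using ab j by blast
    then have "?y b < ?y a"
      using kuhn_simplex_coord_strict[OF lu(1) 1(3), of i j x D] i j x by (simp add: 1)
    obtain i' where i': "b = \<pi>' i'" "i' < k" using ab by auto
    obtain j' where j': "a = \<pi>' j'" "j' < CARD('n)"
      using surj by (metis UNIV_I image_iff lessThan_iff)
    have "\<not> j' < k" using ab j' by blast
    then have "?y a \<le> ?y b"
      using kuhn_simplex_coord_mono[OF lu(1) 2(3), of i' j' x D] i' j' x' by (simp add: 2 eq)
    with \<open>?y b < ?y a\<close> show False by simp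
  qed
  then show ?thesis by (auto simp: 1 2 eq kuhn_simplex_def)
qed

lemma mesh_interp_kuhn:
  assumes "V \<in> kuhn_mesh G D" "x \<in> open_simplex V"
  shows "mesh_interp (kuhn_mesh G D) f x = lin_interp V f x"
proof -
  have "x \<in> convex hull V" using assms(2) interior_subset by (auto simp: open_simplex_def)
  then have "(SOME V'. V' \<in> kuhn_mesh G D \<and> x \<in> convex hull V') = V"
    using assms kuhn_mesh_element_unique by (intro some_equality) blast+
  then show ?thesis by (simp add: mesh_interp_def)
qed

text \<open>The edge joins the corners just before and just after the move in direction
  \<open>j\<close>; \<open>\<tau>\<close> is negative when \<open>j \<in> D\<close>.\<close>

lemma kuhn_simplex_axis_edge:
  fixes l u :: "real^'n::finite"
  assumes lu: "\<forall>j. l $ j < u $ j" and \<pi>: "bij_betw \<pi> {..<CARD('n)} UNIV"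
  obtains a b \<tau> where "a \<in> kuhn_simplex D l u \<pi>" "b \<in> kuhn_simplex D l u \<pi>" "\<tau> \<noteq> 0"
    "b - a = \<tau> *\<^sub>R axis j 1"
proof -
  obtain k where k: "\<pi> k = j" "k < CARD('n)"
    using \<pi> by (metis UNIV_I bij_betw_def image_iff lessThan_iff)
  have inj: "inj_on \<pi> {..<CARD('n)}" using \<pi> by (simp add: bij_betw_def)
  let ?I = "\<pi> ` {..<k}"
  define \<tau> where "\<tau> = (if j \<in> D then l $ j - u $ j else u $ j - l $ j)"
  have "j \<notin> ?I" using inj_on_image_mem_iff[OF inj, of k "{..<k}"] k by auto
  then have "cell_corner D l u (insert j ?I) - cell_corner D l u ?I = \<tau> *\<^sub>R axis j 1"
    by (auto simp: vec_eq_iff cell_corner_def \<tau>_def axis_def)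
  moreover have "insert j ?I = \<pi> ` {..<Suc k}" using k by (simp add: lessThan_Suc)
  moreover have "\<tau> \<noteq> 0" using lu[rule_format, of j] by (simp add: \<tau>_def)
  ultimately show ?thesis
    using that[of "cell_corner D l u ?I" "cell_corner D l u (\<pi> ` {..<Suc k})" \<tau>] k
    by (auto simp: kuhn_simplex_def)
qed

text \<open>
  This is where the Cartesian structure enters: along an edge in direction \<open>j\<close> the positive part
  grows by a fraction in \<open>[0, 1]\<close> of the growth of the affine function, so the slope is a sum of such
  fractions of \<open>(n $ j)\<^sup>2\<close>. On a simplex without axis-parallel edges the bounds may fail.
\<close>
lemma interp_pos_part_slope:
  fixes W :: "real^'n::finite \<Rightarrow> real"
  assumes W: "linear W" and n: "norm n = 1"
    and edges: "\<And>j. \<exists>a\<in>V. \<exists>b\<in>V. \<exists>\<tau>. \<tau> \<noteq> 0 \<and> b - a = \<tau> *\<^sub>R axis j 1"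
    and interp: "\<And>a. a \<in> V \<Longrightarrow> W a + c = max (n \<bullet> (a - y)) 0"
  shows "0 \<le> W n" "W n \<le> 1"
proof -
  interpret W: linear W by (rule W)
  have *: "0 \<le> n $ j * W (axis j 1) \<and> n $ j * W (axis j 1) \<le> n $ j * n $ j" for j
  proof -
    obtain a b \<tau> where ab: "a \<in> V" "b \<in> V" "\<tau> \<noteq> 0" "b - a = \<tau> *\<^sub>R axis j 1"
      using edges by blast
    let ?s = "\<lambda>x. n \<bullet> (x - y)"
    have "n \<bullet> (b - a) = \<tau> * n $ j" unfolding ab(4) by (simp add: inner_axis)
    then have s: "?s b = ?s a + \<tau> * n $ j" by (simp add: inner_diff_right)
    have "W b - W a = \<tau> * W (axis j 1)" unfolding W.diff[symmetric] ab(4) by (simp add: W.scaleR)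
    then have m: "\<tau> * W (axis j 1) = max (?s a + \<tau> * n $ j) 0 - max (?s a) 0"
      using interp[OF ab(1)] interp[OF ab(2)] s by simp
    \<comment> \<open>The factor \<open>e\<close> makes the bounds independent of the sign of the
      increment. For \<open>e = \<tau> * n $ j\<close> a factor \<open>\<tau>\<^sup>2\<close> can be
      cancelled afterwards.\<close>
    have "0 \<le> e * (max (r + e) 0 - max r 0) \<and> e * (max (r + e) 0 - max r 0) \<le> e * e"
      for r e :: real
      by (cases "e \<ge> 0")
        (auto simp: max_def mult_left_mono mult_left_mono_neg zero_le_mult_iff mult_le_0_iff)
    from this[of "\<tau> * n $ j" "?s a"]
    have "0 \<le> \<tau>\<^sup>2 * (n $ j * W (axis j 1)) \<and> \<tau>\<^sup>2 * (n $ j * W (axis j 1)) \<le> \<tau>\<^sup>2 * (n $ j * n $ j)"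
      unfolding m[symmetric] by (simp add: power2_eq_square mult_ac)
    then show ?thesis using ab(3) by (simp add: zero_le_mult_iff mult_le_cancel_left)
  qed
  have "W n = W (\<Sum>j\<in>UNIV. n $ j *\<^sub>R axis j 1)"
    using basis_expansion[of n] by (simp add: scalar_mult_eq_scaleR)
  then have Wn: "W n = (\<Sum>j\<in>UNIV. n $ j * W (axis j 1))" by (simp add: W.sum W.scaleR)
  have "(\<Sum>j\<in>UNIV. n $ j * n $ j) = 1" using n by (simp add: norm_eq_1 inner_vec_def)
  then show "0 \<le> W n" "W n \<le> 1"
    unfolding Wn using * by (auto intro: sum_nonneg) (metis (no_types, lifting) sum_mono)
qed

section \<open>The local problem on a cut simplex\<close>

text \<open>Together with \<open>n\<close> the \<open>t i\<close> are \<open>CARD('n)\<close>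
  orthonormal vectors, hence they span the space. The remainder of the expansion is orthogonal to
  all of them, so to itself.\<close>

lemma orthonormal_complement_expansion:
  fixes n a :: "real^'n" and t :: "nat \<Rightarrow> real^'n"
  assumes n: "norm n = 1" and a: "a \<bullet> n = 0"
    and t1: "\<forall>i\<in>{1..CARD('n)-1}. norm (t i) = 1 \<and> t i \<bullet> n = 0"
    and t2: "\<forall>i\<in>{1..CARD('n)-1}. \<forall>j\<in>{1..CARD('n)-1}. i \<noteq> j \<longrightarrow> t i \<bullet> t j = 0"
  shows "a = (\<Sum>i=1..CARD('n)-1. (a \<bullet> t i) *\<^sub>R t i)"
proof -
  let ?J = "{1..CARD('n)-1}"
  let ?B = "insert n (t ` ?J)"
  have nn: "n \<bullet> n = 1" and tt: "\<And>i. i \<in> ?J \<Longrightarrow> t i \<bullet> t i = 1"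
    using n t1 by (simp_all add: norm_eq_1)
  have inj: "inj_on t ?J" using t2 tt by (intro inj_onI) (metis zero_neq_one)
  have "n \<notin> t ` ?J" using t1 nn by (metis imageE zero_neq_one)
  then have card: "card ?B = CARD('n)" using inj by (simp add: card_image)
  have "pairwise orthogonal ?B"
    using t1 t2 by (auto simp: pairwise_insert pairwise_image pairwise_def orthogonal_def inner_commute)
  moreover have "0 \<notin> ?B" using nn tt by (metis image_iff inner_zero_left insert_iff zero_neq_one)
  ultimately have "independent ?B" by (simp add: pairwise_orthogonal_independent)
  then have span: "UNIV \<subseteq> span ?B" using card by (intro card_ge_dim_independent) simp_all
  define r where "r = a - (\<Sum>i\<in>?J. (a \<bullet> t i) *\<^sub>R t i)"
  have "orthogonal r b" if "b \<in> ?B" for b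
  proof (cases "b = n")
    case True
    then show ?thesis using t1 a by (simp add: orthogonal_def r_def inner_diff_left inner_sum_left)
  next
    case False
    then obtain j where j: "j \<in> ?J" "b = t j" using \<open>b \<in> ?B\<close> by blast
    have "(\<Sum>i\<in>?J. (a \<bullet> t i) * (t i \<bullet> t j)) = (\<Sum>i\<in>?J. if i = j then a \<bullet> t j else 0)"
      using j t2 tt by (intro sum.cong) auto
    then show ?thesis using j by (simp add: orthogonal_def r_def inner_diff_left inner_sum_left)
  qed
  then have "orthogonal r r" using span orthogonal_to_span[of r ?B r] by blast
  then show ?thesis by (simp add: orthogonal_def r_def)
qed

lemma broken_P1_I:
  assumes "f \<in> extensional (Tp \<union> Tm)" "p \<in> P1" "\<And>x. x \<in> Tp \<Longrightarrow> f x = p x"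
    "r \<in> P1" "\<And>x. x \<in> Tm \<Longrightarrow> f x = r x"
  shows "f \<in> broken_P1 Tp Tm"
proof -
  have "\<exists>p\<in>P1. \<forall>x\<in>Tp. f x = p x" using assms(2,3) by (intro bexI[of _ p]) auto
  moreover have "\<exists>p\<in>P1. \<forall>x\<in>Tm. f x = p x" using assms(4,5) by (intro bexI[of _ r]) auto
  ultimately show ?thesis using assms(1) by (simp add: broken_P1_def)
qed

text \<open>What the algebra needs to know about an interface element. \<open>edges\<close> carries
  the Cartesian structure, and \<open>sign\<close> ties the vertex values of \<open>d\<close> to the
  two sides of the cutting hyperplane through \<open>y\<close>.\<close>

locale cut_simplex =
  fixes V T Tp Tm \<Gamma>T :: "(real^'n::finite) set" and d :: "real^'n \<Rightarrow> real" and n y :: "real^'n"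
  assumes indep: "\<not> affine_dependent V" and hull: "affine hull V = UNIV"
    and edges: "\<And>j. \<exists>a\<in>V. \<exists>b\<in>V. \<exists>\<tau>. \<tau> \<noteq> 0 \<and> b - a = \<tau> *\<^sub>R axis j 1"
    and openT: "open T" and yT: "y \<in> T" and n: "norm n = 1"
    and Tp: "Tp = {x\<in>T. n \<bullet> (x - y) > 0}"
    and Tm: "Tm = {x\<in>T. n \<bullet> (x - y) < 0}"
    and \<Gamma>T: "\<Gamma>T = {x\<in>T. n \<bullet> (x - y) = 0}"
    and sign: "\<And>a. a \<in> V \<Longrightarrow> d a > 0 \<longleftrightarrow> n \<bullet> (a - y) > 0"
begin

definition height :: "real^'n \<Rightarrow> real" where "height x = n \<bullet> (x - y)"
text \<open>On the plus side the height is the distance to the hyperplane, but visibly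
  affine.\<close>

definition w :: "real^'n \<Rightarrow> real" where "w x = (if x \<in> Tp then height x else 0)"
definition z :: "real^'n \<Rightarrow> real" where "z x = (if x \<in> Tp then -1 else 0)"
definition Iw :: "real^'n \<Rightarrow> real" where "Iw = lin_interp V (vertex_value d Tp Tm w)"
definition Iz :: "real^'n \<Rightarrow> real" where "Iz = lin_interp V (vertex_value d Tp Tm z)"
text \<open>The linear part of \<open>Iw\<close> evaluated at \<open>n\<close>, i.e. the normal
  derivative of \<open>Iw\<close>.\<close>

definition \<theta> :: real where "\<theta> = Iw n - Iw 0"

lemma nn: "n \<bullet> n = 1"
  using n by (simp add: norm_eq_1)

lemma height_P1: "height \<in> P1"
  using P1_inner[of n y] by (simp add: height_def[abs_def])

lemma open_Tp: "open Tp" and open_Tm: "open Tm"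
proof -
  have "Tp = T \<inter> {x. n \<bullet> x > n \<bullet> y}" "Tm = T \<inter> {x. n \<bullet> x < n \<bullet> y}"
    by (auto simp: Tp Tm inner_diff_right)
  then show "open Tp" "open Tm"
    using openT by (simp_all add: open_Int open_halfspace_gt open_halfspace_lt)
qed

lemma Tp_nonempty: "Tp \<noteq> {}"
  using open_small_stepE[OF openT yT, of n] nn unfolding Tp
  by (metis (mono_tags, lifting) add_diff_cancel_left' empty_iff inner_scaleR_right mem_Collect_eq mult.right_neutral)

lemma Tm_nonempty: "Tm \<noteq> {}"
proof -
  obtain e where "e > 0" "y + e *\<^sub>R (- n) \<in> T"
    using open_small_stepE[OF openT yT, of "- n"] by blast
  then have "y + e *\<^sub>R (- n) \<in> Tm" by (simp add: Tm nn)
  then show ?thesis by blast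
qed

lemma disjoint: "x \<in> Tp \<Longrightarrow> x \<notin> Tm"
  by (simp add: Tp Tm)

lemmas poly_ext_Tp = poly_ext_eqI[OF open_Tp Tp_nonempty]
  and poly_ext_Tm = poly_ext_eqI[OF open_Tm Tm_nonempty]

lemma broken_P1_poly_ext:
  assumes "f \<in> broken_P1 Tp Tm"
  shows "poly_ext Tp f \<in> P1" "x \<in> Tp \<Longrightarrow> f x = poly_ext Tp f x"
    "poly_ext Tm f \<in> P1" "x \<in> Tm \<Longrightarrow> f x = poly_ext Tm f x"
proof -
  obtain p where p: "p \<in> P1" "\<forall>x\<in>Tp. f x = p x" using assms by (auto simp: broken_P1_def)
  have "poly_ext Tp f = p" using poly_ext_Tp[OF p(1)] p(2) by blast
  then show "poly_ext Tp f \<in> P1" "x \<in> Tp \<Longrightarrow> f x = poly_ext Tp f x" using p by auto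
  obtain p where p: "p \<in> P1" "\<forall>x\<in>Tm. f x = p x" using assms by (auto simp: broken_P1_def)
  have "poly_ext Tm f = p" using poly_ext_Tm[OF p(1)] p(2) by blast
  then show "poly_ext Tm f \<in> P1" "x \<in> Tm \<Longrightarrow> f x = poly_ext Tm f x" using p by auto
qed

lemma Iw_P1: "Iw \<in> P1" and Iz_P1: "Iz \<in> P1"
  by (simp_all add: Iw_def Iz_def lin_interp_P1[OF indep hull])

lemma Iw_vertex: "a \<in> V \<Longrightarrow> Iw a = (if d a > 0 then height a else 0)"
proof -
  have "poly_ext Tp w = height"
    by (rule poly_ext_Tp[OF height_P1]) (simp add: w_def)
  moreover have "poly_ext Tm w = (\<lambda>x. 0)"
    by (rule poly_ext_Tm[OF P1_const]) (auto simp: w_def disjoint)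
  moreover assume "a \<in> V"
  ultimately show ?thesis
    by (simp add: Iw_def lin_interp_vertex[OF indep hull] vertex_value_def)
qed

lemma Iz_vertex: "a \<in> V \<Longrightarrow> Iz a = (if d a > 0 then -1 else 0)"
proof -
  have "poly_ext Tp z = (\<lambda>x. -1)"
    by (rule poly_ext_Tp[OF P1_const]) (simp add: z_def)
  moreover have "poly_ext Tm z = (\<lambda>x. 0)"
    by (rule poly_ext_Tm[OF P1_const]) (auto simp: z_def disjoint)
  moreover assume "a \<in> V"
  ultimately show ?thesis
    by (simp add: Iz_def lin_interp_vertex[OF indep hull] vertex_value_def)
qed

text \<open>By \<open>sign\<close>, the vertex values of \<open>Iw\<close> are those of the positive
  part of \<open>height\<close>.\<close>

lemma \<theta>_bounds: "0 \<le> \<theta>" "\<theta> \<le> 1"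
proof -
  obtain W c where W: "linear W" "Iw = (\<lambda>x. W x + c)" using Iw_P1 by (rule P1_E)
  have "W a + c = max (n \<bullet> (a - y)) 0" if "a \<in> V" for a
    using Iw_vertex[OF that] sign[OF that] by (auto simp: W height_def)
  note bounds = interp_pos_part_slope[OF W(1) n edges this]
  have "\<theta> = W n" using linear_0[OF W(1)] by (simp add: \<theta>_def W)
  then show "0 \<le> \<theta>" "\<theta> \<le> 1" using bounds by simp_all
qed

text \<open>The expression is the convex combination of \<open>\<mu>p\<close> and
  \<open>\<mu>m\<close> with weights \<open>1 - \<theta>\<close> and
  \<open>\<theta>\<close>.\<close>

lemma coefficient_pos:
  assumes "\<mu>p > 0" "\<mu>m > 0"
  shows "\<mu>p + (\<mu>m - \<mu>p) * \<theta> > 0"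
proof -
  have "\<mu>p + (\<mu>m - \<mu>p) * \<theta> = \<mu>p * (1 - \<theta>) + \<mu>m * \<theta>" by (simp add: algebra_simps)
  moreover have "\<mu>p * (1 - \<theta>) \<ge> 0" "\<mu>m * \<theta> \<ge> 0" using \<theta>_bounds assms by simp_all
  moreover have "\<mu>p * (1 - \<theta>) > 0 \<or> \<mu>m * \<theta> > 0" using \<theta>_bounds assms by (cases "\<theta> = 0") simp_all
  ultimately show ?thesis by linarith
qed

lemma vanishing_jump:
  fixes p q :: "real^'n \<Rightarrow> 'b::real_vector"
  assumes "p \<in> P1" "q \<in> P1" "\<forall>x\<in>\<Gamma>T. p x - q x = 0"
  obtains a where "p = (\<lambda>x. q x + height x *\<^sub>R a)"
proof -
  obtain L b where L: "linear L" "(\<lambda>x. p x - q x) = (\<lambda>x. L x + b)"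
    using P1_diff[OF assms(1,2)] by (rule P1_E)
  have pq: "p x - q x = L x + b" for x using fun_cong[OF L(2)] .
  have "\<forall>x\<in>T. n \<bullet> (x - y) = 0 \<longrightarrow> L x + b = 0"
    using assms(3) unfolding \<Gamma>T pq by blast
  from affine_vanishing_on_slice[OF L(1) openT yT n this]
  have "p x - q x = height x *\<^sub>R L n" for x by (simp add: pq height_def)
  then have "p = (\<lambda>x. q x + height x *\<^sub>R L n)" by (simp add: fun_eq_iff algebra_simps)
  then show ?thesis by (rule that)
qed

text \<open>
  The jump of the velocity being \<open>height x *\<^sub>R a\<close>, its divergence is \<open>a \<bullet> n\<close>, and its strain applied
  to \<open>n\<close> is half of \<open>a\<close> as soon as \<open>a\<close> is tangential.
\<close>
lemma jump_conditions_iff: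
  fixes A :: "real^'n \<Rightarrow> real^'n" and B :: "real^'n \<Rightarrow> real"
  assumes A: "linear A" and v: "v \<in> broken_P1 Tp Tm" and q: "q \<in> broken_P1 Tp Tm"
    and vm: "poly_ext Tm v = (\<lambda>x. A x + b)"
    and vp: "poly_ext Tp v = (\<lambda>x. poly_ext Tm v x + height x *\<^sub>R a)"
    and qp: "poly_ext Tp q = (\<lambda>x. poly_ext Tm q x + \<delta>)"
  shows "(v, q) \<in> IFE_space \<mu>p \<mu>m Tp Tm \<Gamma>T y n \<longleftrightarrow>
    a \<bullet> n = 0 \<and> (\<mu>p - \<mu>m) *\<^sub>R (A n + adjoint A n) + \<mu>p *\<^sub>R a = \<delta> *\<^sub>R n"
proof -
  let ?A = "\<lambda>x. A x + (n \<bullet> x) *\<^sub>R a"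
  have inn: "linear ((\<bullet>) n)" by (simp add: bounded_linear.linear bounded_linear_inner_right)
  have A': "linear ?A"
    using A by (intro linear_compose_add) (simp_all add: linear_iff inner_add_right scaleR_add_left)
  have vp': "poly_ext Tp v = (\<lambda>x. ?A x + (b - (n \<bullet> y) *\<^sub>R a))"
    unfolding vp vm by (simp add: fun_eq_iff height_def inner_diff_right algebra_simps)
  obtain B \<beta> where B: "linear B" "poly_ext Tm q = (\<lambda>x. B x + \<beta>)"
    using broken_P1_poly_ext(3)[OF q] by (rule P1_E)
  have qp': "poly_ext Tp q = (\<lambda>x. B x + (\<beta> + \<delta>))" unfolding qp B by (simp add: add.assoc)
  have "height x = 0" if "x \<in> \<Gamma>T" for x using that by (simp add: \<Gamma>T height_def)
  then have jump: "\<forall>x\<in>\<Gamma>T. poly_ext Tp v x - poly_ext Tm v x = 0" by (simp add: vp)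
  have "grad (poly_ext Tp q) x \<bullet> e = grad (poly_ext Tm q) x \<bullet> e" for x e
    unfolding qp' unfolding B grad_P1[OF B(1)] ..
  then have grad: "grad (poly_ext Tp q) x = grad (poly_ext Tm q) x" for x
    by (metis vector_eq_rdot)
  have "n \<bullet> axis i 1 = n $ i" for i by (simp add: inner_axis)
  then have "(\<Sum>i\<in>UNIV. (n \<bullet> axis i 1) * a $ i) = n \<bullet> a"
    by (simp add: inner_vec_def[of n a])
  then have div: "divergence (poly_ext Tp v) x - divergence (poly_ext Tm v) x = n \<bullet> a" for x
    unfolding vp' unfolding vm divergence_P1[OF A'] divergence_P1[OF A]
    by (simp add: sum.distrib)
  \<comment> \<open>The interface piece is nonempty, so the divergence condition on it is not
    vacuous.\<close>
  have "y \<in> \<Gamma>T" using yT by (simp add: \<Gamma>T)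
  then have div': "(\<forall>x\<in>\<Gamma>T. divergence (poly_ext Tp v) x - divergence (poly_ext Tm v) x = 0)
      \<longleftrightarrow> a \<bullet> n = 0"
    unfolding div by (auto simp: inner_commute)
  have "stress \<mu>p (poly_ext Tp v) (poly_ext Tp q) y *v n
      - stress \<mu>m (poly_ext Tm v) (poly_ext Tm q) y *v n
      = (\<mu>p - \<mu>m) *\<^sub>R (A n + adjoint A n) + \<mu>p *\<^sub>R a - \<delta> *\<^sub>R n" if "a \<bullet> n = 0"
  proof -
    have "adjoint ?A n = adjoint A n" by (rule adjoint_add_rank_one[OF A inn that])
    then show ?thesis
      unfolding vp' unfolding vm qp stress_P1[OF A'] stress_P1[OF A]
      by (simp add: nn algebra_simps)
  qed
  then show ?thesis
    unfolding IFE_space_def using v q jump grad div' by auto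
qed

text \<open>Trades the unknown minus pieces for the interpolants, which the nodal values fix. What
  remains unknown are the jump parameters \<open>a\<close> and \<open>\<delta>\<close>, subject to
  one vector equation.\<close>

lemma IFE_interp_iff:
  fixes C :: "real^'n \<Rightarrow> real^'n" and Q :: "real^'n \<Rightarrow> real"
  assumes C: "linear C" and Q: "Q \<in> P1"
  shows "(v, q) \<in> IFE_space \<mu>p \<mu>m Tp Tm \<Gamma>T y n \<and>
      (\<forall>a\<in>V. vertex_value d Tp Tm v a = C a + c \<and> vertex_value d Tp Tm q a = Q a) \<longleftrightarrow>
    (\<exists>a \<delta>. a \<bullet> n = 0 \<and>
      (\<mu>p + (\<mu>m - \<mu>p) * \<theta>) *\<^sub>R a + (\<mu>p - \<mu>m) *\<^sub>R (C n + adjoint C n) = \<delta> *\<^sub>R n \<and>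
      v = (\<lambda>x\<in>Tp \<union> Tm. C x + c + (w x - Iw x) *\<^sub>R a) \<and>
      q = (\<lambda>x\<in>Tp \<union> Tm. Q x - \<delta> * (z x - Iz x)))" (is "?L \<longleftrightarrow> (\<exists>a \<delta>. ?R a \<delta>)")
proof -
  obtain W w0 where W: "linear W" "Iw = (\<lambda>x. W x + w0)" using Iw_P1 by (rule P1_E)
  have \<theta>: "\<theta> = W n" using linear_0[OF W(1)] by (simp add: \<theta>_def W)
  \<comment> \<open>Substituting \<open>A n = C n - \<theta> *\<^sub>R a\<close> moves
    \<open>\<theta>\<close> into the coefficient of \<open>a\<close>; the adjoint is unaffected
    because \<open>a\<close> is tangential.\<close>
  have balance: "(\<mu>p - \<mu>m) *\<^sub>R (A n + adjoint A n) + \<mu>p *\<^sub>R a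
      = (\<mu>p + (\<mu>m - \<mu>p) * \<theta>) *\<^sub>R a + (\<mu>p - \<mu>m) *\<^sub>R (C n + adjoint C n)"
    if A: "linear A" "C = (\<lambda>x. A x + W x *\<^sub>R a)" "a \<bullet> n = 0" for A a
  proof -
    have "adjoint C n = adjoint A n" unfolding A(2) by (rule adjoint_add_rank_one[OF A(1) W(1) A(3)])
    then show ?thesis using A(2) by (simp add: \<theta> algebra_simps)
  qed
  show ?thesis
  proof
    assume L: ?L
    then have v: "v \<in> broken_P1 Tp Tm" and q: "q \<in> broken_P1 Tp Tm"
      and jump: "\<forall>x\<in>\<Gamma>T. poly_ext Tp v x - poly_ext Tm v x = 0"
      and grad: "\<forall>x\<in>\<Gamma>T. grad (poly_ext Tp q) x - grad (poly_ext Tm q) x = 0"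
      by (auto simp: IFE_space_def)
    note v_ext = broken_P1_poly_ext[OF v] and q_ext = broken_P1_poly_ext[OF q]
    obtain a where a: "poly_ext Tp v = (\<lambda>x. poly_ext Tm v x + height x *\<^sub>R a)"
      using vanishing_jump[OF v_ext(1,3) jump] .
    obtain A b where A: "linear A" "poly_ext Tm v = (\<lambda>x. A x + b)" using v_ext(3) by (rule P1_E)
    obtain B \<beta> where B: "linear B" "poly_ext Tm q = (\<lambda>x. B x + \<beta>)" using q_ext(3) by (rule P1_E)
    obtain B' \<beta>' where B': "linear B'" "poly_ext Tp q = (\<lambda>x. B' x + \<beta>')" using q_ext(1) by (rule P1_E)
    have "y \<in> \<Gamma>T" using yT by (simp add: \<Gamma>T)
    then have "grad (poly_ext Tp q) y = grad (poly_ext Tm q) y" using grad by simp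
    then have "B' = B"
      using grad_P1[OF B(1), of \<beta> y] grad_P1[OF B'(1), of \<beta>' y] by (simp add: B(2) B'(2) fun_eq_iff)
    define \<delta> where "\<delta> = \<beta>' - \<beta>"
    have \<delta>: "poly_ext Tp q = (\<lambda>x. poly_ext Tm q x + \<delta>)"
      unfolding B'(2) B(2) \<open>B' = B\<close> by (simp add: \<delta>_def)
    from jump_conditions_iff[OF A(1) v q A(2) a \<delta>] L
    have cond: "a \<bullet> n = 0" "(\<mu>p - \<mu>m) *\<^sub>R (A n + adjoint A n) + \<mu>p *\<^sub>R a = \<delta> *\<^sub>R n" by blast+
    \<comment> \<open>At plus vertices \<open>Iw\<close> equals the height, which supplies the jump;
      at all others it vanishes.\<close>
    have "(\<lambda>x. C x + c) = (\<lambda>x. poly_ext Tm v x + Iw x *\<^sub>R a)"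
    proof (rule P1_eq_affine_hull[OF P1_I[OF C] P1_add[OF v_ext(3) P1_scaleR[OF Iw_P1]] hull])
      show "\<forall>x\<in>V. C x + c = poly_ext Tm v x + Iw x *\<^sub>R a"
        using L by (auto simp: vertex_value_def Iw_vertex a split: if_splits)
    qed
    then have Cv: "C x + c = A x + b + (W x + w0) *\<^sub>R a" for x by (simp add: fun_eq_iff A W)
    have "C x = A x + W x *\<^sub>R a" for x
      using Cv[of x] Cv[of 0] linear_0[OF C] linear_0[OF A(1)] linear_0[OF W(1)]
      by (simp add: algebra_simps)
    then have CA: "C = (\<lambda>x. A x + W x *\<^sub>R a)" by blast
    \<comment> \<open>Since \<open>Iz\<close> is \<open>-1\<close> at plus vertices, the subtraction
      adds the jump \<open>\<delta>\<close> exactly there.\<close>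
    have "Q = (\<lambda>x. poly_ext Tm q x - Iz x *\<^sub>R \<delta>)"
    proof (rule P1_eq_affine_hull[OF Q P1_diff[OF q_ext(3) P1_scaleR[OF Iz_P1]] hull])
      show "\<forall>x\<in>V. Q x = poly_ext Tm q x - Iz x *\<^sub>R \<delta>"
        using L by (auto simp: vertex_value_def Iz_vertex \<delta> split: if_splits)
    qed
    then have Qq: "poly_ext Tm q x = Q x + \<delta> * Iz x" for x by simp
    have "v = (\<lambda>x\<in>Tp \<union> Tm. C x + c + (w x - Iw x) *\<^sub>R a)"
    proof (rule extensionalityI)
      show "v \<in> extensional (Tp \<union> Tm)" using v by (simp add: broken_P1_def)
      fix x assume "x \<in> Tp \<union> Tm"
      then show "v x = (\<lambda>x\<in>Tp \<union> Tm. C x + c + (w x - Iw x) *\<^sub>R a) x"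
        using v_ext(2,4)[of x] disjoint[of x] unfolding Cv by (auto simp: W a A w_def algebra_simps)
    qed simp
    moreover have "q = (\<lambda>x\<in>Tp \<union> Tm. Q x - \<delta> * (z x - Iz x))"
    proof (rule extensionalityI)
      show "q \<in> extensional (Tp \<union> Tm)" using q by (simp add: broken_P1_def)
      fix x assume "x \<in> Tp \<union> Tm"
      then show "q x = (\<lambda>x\<in>Tp \<union> Tm. Q x - \<delta> * (z x - Iz x)) x"
        using q_ext(2,4)[of x] disjoint[of x] by (auto simp: Qq \<delta> z_def algebra_simps)
    qed simp
    ultimately have "?R a \<delta>" using cond balance[OF A(1) CA cond(1)] by simp
    then show "\<exists>a \<delta>. ?R a \<delta>" by blast
  next
    assume "\<exists>a \<delta>. ?R a \<delta>"
    then obtain a \<delta> where R: "?R a \<delta>" by blast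
    then have veq: "v = (\<lambda>x\<in>Tp \<union> Tm. C x + c + (w x - Iw x) *\<^sub>R a)"
      and qeq: "q = (\<lambda>x\<in>Tp \<union> Tm. Q x - \<delta> * (z x - Iz x))" by blast+
    \<comment> \<open>\<open>A\<close>, \<open>b\<close> and \<open>Qm\<close> are the minus pieces
      read off from the formulas for \<open>v\<close> and \<open>q\<close>, where \<open>w\<close>
      and \<open>z\<close> vanish.\<close>
    define A where "A = (\<lambda>x. C x - W x *\<^sub>R a)"
    have A: "linear A"
      unfolding A_def using W(1) by (intro linear_compose_sub[OF C]) (simp add: linear_iff scaleR_add_left)
    define b where "b = c - w0 *\<^sub>R a"
    have Ab: "A x + b = C x + c - Iw x *\<^sub>R a" for x by (simp add: A_def b_def W algebra_simps)
    define Qm where "Qm = (\<lambda>x. Q x - (- Iz x) *\<^sub>R \<delta>)"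
    have Qm: "Qm \<in> P1"
      using P1_diff[OF Q P1_scaleR[OF P1_diff[OF P1_const[of 0] Iz_P1]]] by (simp add: Qm_def)
    have vp1: "(\<lambda>x. A x + b + height x *\<^sub>R a) \<in> P1" by (intro P1_add P1_I A P1_scaleR height_P1)
    have qp1: "(\<lambda>x. Qm x + \<delta>) \<in> P1" by (intro P1_add Qm P1_const)
    have von: "x \<in> Tp \<Longrightarrow> v x = A x + b + height x *\<^sub>R a" "x \<in> Tm \<Longrightarrow> v x = A x + b"
      and qon: "x \<in> Tp \<Longrightarrow> q x = Qm x + \<delta>" "x \<in> Tm \<Longrightarrow> q x = Qm x" for x
      unfolding Ab Qm_def veq qeq using disjoint[of x]
      by (auto simp: w_def z_def algebra_simps)
    have vp: "poly_ext Tp v = (\<lambda>x. A x + b + height x *\<^sub>R a)" by (rule poly_ext_Tp[OF vp1 von(1)])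
    have vm: "poly_ext Tm v = (\<lambda>x. A x + b)" by (rule poly_ext_Tm[OF P1_I[OF A] von(2)])
    have qp: "poly_ext Tp q = (\<lambda>x. Qm x + \<delta>)" by (rule poly_ext_Tp[OF qp1 qon(1)])
    have qm: "poly_ext Tm q = Qm" by (rule poly_ext_Tm[OF Qm qon(2)])
    have v: "v \<in> broken_P1 Tp Tm"
      by (rule broken_P1_I[OF _ vp1 von(1) P1_I[OF A] von(2)]) (simp only: veq restrict_extensional)
    have q: "q \<in> broken_P1 Tp Tm"
      by (rule broken_P1_I[OF _ qp1 qon(1) Qm qon(2)]) (simp only: qeq restrict_extensional)
    have "C = (\<lambda>x. A x + W x *\<^sub>R a)" by (simp add: A_def)
    then have "(\<mu>p - \<mu>m) *\<^sub>R (A n + adjoint A n) + \<mu>p *\<^sub>R a = \<delta> *\<^sub>R n"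
      using balance[OF A] R by simp
    moreover have "poly_ext Tp v = (\<lambda>x. poly_ext Tm v x + height x *\<^sub>R a)"
      "poly_ext Tp q = (\<lambda>x. poly_ext Tm q x + \<delta>)" unfolding vp vm qp qm by simp_all
    ultimately have "(v, q) \<in> IFE_space \<mu>p \<mu>m Tp Tm \<Gamma>T y n"
      using jump_conditions_iff[OF A v q vm] R by blast
    moreover have "vertex_value d Tp Tm v x = C x + c \<and> vertex_value d Tp Tm q x = Q x"
      if "x \<in> V" for x
      using that by (simp add: vertex_value_def vp vm qp qm Ab Qm_def Iw_vertex Iz_vertex)
    ultimately show ?L by blast
  qed
qed

text \<open>With \<open>a\<close> tangential, the normal component of the vector equation yields
  \<open>\<delta>\<close>, and the rest yields \<open>a\<close> after division by the positive
  coefficient \<open>K\<close>.\<close>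

lemma IFE_unisolvent:
  fixes \<alpha> :: "real^'n \<Rightarrow> real^'n" and \<beta> :: "real^'n \<Rightarrow> real"
  assumes mu: "\<mu>p > 0" "\<mu>m > 0"
  shows "\<exists>!(v, q). (v, q) \<in> IFE_space \<mu>p \<mu>m Tp Tm \<Gamma>T y n \<and>
    (\<forall>a\<in>V. vertex_value d Tp Tm v a = \<alpha> a \<and> vertex_value d Tp Tm q a = \<beta> a)"
proof -
  obtain C c where C: "linear C" "lin_interp V \<alpha> = (\<lambda>x. C x + c)"
    using lin_interp_P1[OF indep hull] by (rule P1_E)
  note Q = lin_interp_P1[OF indep hull, of \<beta>]
  have \<alpha>: "\<alpha> a = C a + c" "\<beta> a = lin_interp V \<beta> a" if "a \<in> V" for a
    using lin_interp_vertex[OF indep hull that] C(2) by metis+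
  define K where "K = \<mu>p + (\<mu>m - \<mu>p) * \<theta>"
  have K: "K > 0" using coefficient_pos[OF mu] by (simp add: K_def)
  define E where "E = (\<mu>p - \<mu>m) *\<^sub>R (C n + adjoint C n)"
  have solve: "a \<bullet> n = 0 \<and> K *\<^sub>R a + E = \<delta> *\<^sub>R n \<longleftrightarrow>
      \<delta> = E \<bullet> n \<and> a = (1 / K) *\<^sub>R ((E \<bullet> n) *\<^sub>R n - E)" for a \<delta>
  proof
    assume "a \<bullet> n = 0 \<and> K *\<^sub>R a + E = \<delta> *\<^sub>R n"
    then have *: "a \<bullet> n = 0" "K *\<^sub>R a + E = \<delta> *\<^sub>R n" by simp_all
    then have "(K *\<^sub>R a + E) \<bullet> n = (\<delta> *\<^sub>R n) \<bullet> n" by simp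
    then have \<delta>: "\<delta> = E \<bullet> n" unfolding inner_add_left using *(1) by (simp add: nn)
    then have "K *\<^sub>R a = (E \<bullet> n) *\<^sub>R n - E" using *(2) by (simp add: algebra_simps)
    then have "(1 / K) *\<^sub>R (K *\<^sub>R a) = (1 / K) *\<^sub>R ((E \<bullet> n) *\<^sub>R n - E)" by simp
    then have "a = (1 / K) *\<^sub>R ((E \<bullet> n) *\<^sub>R n - E)" using K by simp
    with \<delta> show "\<delta> = E \<bullet> n \<and> a = (1 / K) *\<^sub>R ((E \<bullet> n) *\<^sub>R n - E)" by blast
  next
    assume "\<delta> = E \<bullet> n \<and> a = (1 / K) *\<^sub>R ((E \<bullet> n) *\<^sub>R n - E)"
    then show "a \<bullet> n = 0 \<and> K *\<^sub>R a + E = \<delta> *\<^sub>R n"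
      using K by (simp add: inner_diff_left nn)
  qed
  define a0 where "a0 = (1 / K) *\<^sub>R ((E \<bullet> n) *\<^sub>R n - E)"
  have iff: "(v, q) \<in> IFE_space \<mu>p \<mu>m Tp Tm \<Gamma>T y n \<and>
    (\<forall>a\<in>V. vertex_value d Tp Tm v a = \<alpha> a \<and> vertex_value d Tp Tm q a = \<beta> a) \<longleftrightarrow>
    v = (\<lambda>x\<in>Tp \<union> Tm. C x + c + (w x - Iw x) *\<^sub>R a0) \<and>
    q = (\<lambda>x\<in>Tp \<union> Tm. lin_interp V \<beta> x - (E \<bullet> n) * (z x - Iz x))" (is "?L v q \<longleftrightarrow> ?R v q") for v q
  proof -
    have "?L v q \<longleftrightarrow> (v, q) \<in> IFE_space \<mu>p \<mu>m Tp Tm \<Gamma>T y n \<and>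
      (\<forall>a\<in>V. vertex_value d Tp Tm v a = C a + c \<and> vertex_value d Tp Tm q a = lin_interp V \<beta> a)"
      using \<alpha> by auto
    also have "\<dots> \<longleftrightarrow> ?R v q"
      unfolding IFE_interp_iff[OF C(1) Q] K_def[symmetric] E_def[symmetric]
        conj_assoc[symmetric] solve a0_def by blast
    finally show ?thesis .
  qed
  show ?thesis
    by (rule ex1I[of _ "(\<lambda>x\<in>Tp \<union> Tm. C x + c + (w x - Iw x) *\<^sub>R a0,
          \<lambda>x\<in>Tp \<union> Tm. lin_interp V \<beta> x - (E \<bullet> n) * (z x - Iz x))"])
      (simp_all add: iff split: prod.splits)
qed

text \<open>Pairing the vector equation with \<open>t i\<close> removes
  \<open>\<delta> *\<^sub>R n\<close>, and pairing it with \<open>n\<close> removes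
  \<open>a\<close>. The tangential equation is solved for an arbitrary \<open>r\<close>, so that it
  gives existence and uniqueness of the coefficients at once.\<close>

lemma IFE_representation:
  fixes t :: "nat \<Rightarrow> real^'n"
  assumes vq: "(v, q) \<in> IFE_space \<mu>p \<mu>m Tp Tm \<Gamma>T y n" and mu: "\<mu>p > 0" "\<mu>m > 0"
    and t: "\<forall>i\<in>J. t i \<bullet> n = 0"
  defines "Iv \<equiv> lin_interp V (vertex_value d Tp Tm v)"
    and "Iq \<equiv> lin_interp V (vertex_value d Tp Tm q)"
  obtains a \<delta> where "a \<bullet> n = 0"
    "\<And>x. x \<in> Tp \<union> Tm \<Longrightarrow> v x = Iv x + (w x - Iw x) *\<^sub>R a"
    "\<And>x. x \<in> Tp \<union> Tm \<Longrightarrow> q x = Iq x - \<delta> * (z x - Iz x)"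
    "\<And>x i r. i \<in> J \<Longrightarrow> (1 + (\<mu>m / \<mu>p - 1) * (grad Iw x \<bullet> n)) * r
        = t i \<bullet> (stress (\<mu>m / \<mu>p - 1) Iv (\<lambda>_. 0) x *v n) \<longleftrightarrow> r = a \<bullet> t i"
    "\<And>x. n \<bullet> (stress (\<mu>m - \<mu>p) Iv (\<lambda>_. 0) x *v n) = - \<delta>"
proof -
  obtain C c where C: "linear C" "Iv = (\<lambda>x. C x + c)"
    using lin_interp_P1[OF indep hull] unfolding Iv_def by (rule P1_E)
  have Q: "Iq \<in> P1" unfolding Iq_def by (rule lin_interp_P1[OF indep hull])
  obtain W w0 where W: "linear W" "Iw = (\<lambda>x. W x + w0)" using Iw_P1 by (rule P1_E)
  have \<theta>: "\<theta> = W n" using linear_0[OF W(1)] by (simp add: \<theta>_def W)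
  \<comment> \<open>No viscosity factor is included, because both stresses in the claim are
    multiples of this vector.\<close>
  define E where "E = C n + adjoint C n"
  define K where "K = \<mu>p + (\<mu>m - \<mu>p) * \<theta>"
  have K: "K > 0" using coefficient_pos[OF mu] by (simp add: K_def)
  have "vertex_value d Tp Tm v a = C a + c \<and> vertex_value d Tp Tm q a = Iq a" if "a \<in> V" for a
    using lin_interp_vertex[OF indep hull that] C(2) unfolding Iv_def Iq_def by metis
  then obtain a \<delta> where a: "a \<bullet> n = 0" "K *\<^sub>R a + (\<mu>p - \<mu>m) *\<^sub>R E = \<delta> *\<^sub>R n"
      "v = (\<lambda>x\<in>Tp \<union> Tm. C x + c + (w x - Iw x) *\<^sub>R a)"
      "q = (\<lambda>x\<in>Tp \<union> Tm. Iq x - \<delta> * (z x - Iz x))"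
    using IFE_interp_iff[OF C(1) Q, of v q \<mu>p \<mu>m c] vq unfolding E_def K_def by blast
  show ?thesis
  proof (rule that[OF a(1), of \<delta>])
    show "v x = Iv x + (w x - Iw x) *\<^sub>R a" "q x = Iq x - \<delta> * (z x - Iz x)"
      if "x \<in> Tp \<union> Tm" for x
      using that a(3,4) C(2) by simp_all
    have stress: "stress \<mu> Iv (\<lambda>_. 0) x *v n = \<mu> *\<^sub>R E" for \<mu> x
      unfolding C(2) stress_P1[OF C(1)] E_def by simp
    have "(K *\<^sub>R a + (\<mu>p - \<mu>m) *\<^sub>R E) \<bullet> n = (\<delta> *\<^sub>R n) \<bullet> n" using a(2) by simp
    then show "n \<bullet> (stress (\<mu>m - \<mu>p) Iv (\<lambda>_. 0) x *v n) = - \<delta>" for x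
      using a(1) by (simp add: stress inner_add_left nn inner_commute algebra_simps)
    fix x i r assume i: "i \<in> J"
    have "(K *\<^sub>R a + (\<mu>p - \<mu>m) *\<^sub>R E) \<bullet> t i = (\<delta> *\<^sub>R n) \<bullet> t i" using a(2) by simp
    then have at: "K * (a \<bullet> t i) = (\<mu>m - \<mu>p) * (t i \<bullet> E)"
      using t i by (simp add: inner_add_left inner_commute algebra_simps)
    have "grad Iw x \<bullet> n = \<theta>" unfolding W(2) grad_P1[OF W(1)] \<theta> ..
    moreover have "1 + (\<mu>m / \<mu>p - 1) * \<theta> = K / \<mu>p" "\<mu>m / \<mu>p - 1 = (\<mu>m - \<mu>p) / \<mu>p"
      using mu by (simp_all add: K_def field_simps)
    ultimately have "(1 + (\<mu>m / \<mu>p - 1) * (grad Iw x \<bullet> n)) * r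
        = t i \<bullet> (stress (\<mu>m / \<mu>p - 1) Iv (\<lambda>_. 0) x *v n) \<longleftrightarrow>
        K / \<mu>p * r = (\<mu>m - \<mu>p) / \<mu>p * (t i \<bullet> E)"
      by (simp add: stress)
    also have "\<dots> \<longleftrightarrow> K * r = K * (a \<bullet> t i)" unfolding at using mu by (simp add: field_simps)
    also have "\<dots> \<longleftrightarrow> r = a \<bullet> t i" using K by simp
    finally show "(1 + (\<mu>m / \<mu>p - 1) * (grad Iw x \<bullet> n)) * r
        = t i \<bullet> (stress (\<mu>m / \<mu>p - 1) Iv (\<lambda>_. 0) x *v n) \<longleftrightarrow> r = a \<bullet> t i" .
  qed
qed

end

section \<open>Elements cut by the discrete interface\<close>

text \<open>The zero set of the affine function contains a relatively open piece of its own
  hyperplane, and \<open>S\<close> contains that piece, so \<open>S\<close> is that hyperplane. Then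
  \<open>n\<close> is parallel to the gradient, and \<open>pos\<close> fixes its
  orientation.\<close>

lemma level_set_normal:
  fixes A :: "real^'n \<Rightarrow> real"
  assumes A: "linear A" and T: "open T" "y \<in> T" and y: "A y + c = 0"
    and S: "hyperplane S" "{x\<in>T. A x + c = 0} \<subseteq> S"
    and n: "norm n = 1" "\<forall>x\<in>S. \<forall>x'\<in>S. n \<bullet> (x - x') = 0"
    and pos: "\<forall>\<^sub>F e in at_right 0. A (y + e *\<^sub>R n) + c > 0"
  obtains \<kappa> where "\<kappa> > 0" "\<And>x. A x + c = \<kappa> * (n \<bullet> (x - y))" "S = {x. n \<bullet> (x - y) = 0}"
proof -
  obtain m b where m: "m \<noteq> 0" "S = {x. m \<bullet> x = b}" using S(1) by (auto simp: hyperplane_def)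
  define g where "g = adjoint A 1"
  have g: "A x = g \<bullet> x" for x
    using adjoint_works[OF A, of x 1] by (simp add: g_def inner_commute)
  have gL: "A x + c = g \<bullet> (x - y)" for x using y by (simp add: g inner_diff_right)
  have "\<forall>\<^sub>F e in at_right (0::real). e > 0 \<and> A (y + e *\<^sub>R n) + c > 0"
    using pos eventually_at_right_less by eventually_elim auto
  from eventually_happens[OF this] obtain e where e: "e > 0" "A (y + e *\<^sub>R n) + c > 0" by auto
  then have gn: "g \<bullet> n > 0" by (simp add: gL zero_less_mult_iff)
  then have "g \<noteq> 0" by auto
  define n' where "n' = (1 / norm g) *\<^sub>R g"
  have n': "norm n' = 1" using \<open>g \<noteq> 0\<close> by (simp add: n'_def)
  have gn': "g = norm g *\<^sub>R n'" using \<open>g \<noteq> 0\<close> by (simp add: n'_def)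
  have "m \<bullet> x + (- b) = 0" if "x \<in> T" "n' \<bullet> (x - y) = 0" for x
  proof -
    have "A x + c = 0" unfolding gL using that(2) by (auto simp: n'_def)
    then show ?thesis using S(2) that(1) by (auto simp: m)
  qed
  then have "m \<bullet> x + (- b) = (n' \<bullet> (x - y)) *\<^sub>R (m \<bullet> n')" for x
    by (intro affine_vanishing_on_slice[OF _ T n'])
      (simp_all add: bounded_linear.linear bounded_linear_inner_right)
  then have mS: "m \<bullet> x - b = (n' \<bullet> (x - y)) * (m \<bullet> n')" for x by simp
  \<comment> \<open>Otherwise the equation of \<open>S\<close> would hold everywhere, contradicting
    \<open>m \<noteq> 0\<close>.\<close>
  have "m \<bullet> n' \<noteq> 0"
  proof
    assume "m \<bullet> n' = 0"
    then have "m \<bullet> m = b" "m \<bullet> 0 = b" using mS[of m] mS[of 0] by simp_all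
    then show False using m(1) by simp
  qed
  then have "m \<bullet> x = b \<longleftrightarrow> n' \<bullet> (x - y) = 0" for x
    by (metis mS eq_iff_diff_eq_0 mult_eq_0_iff)
  then have S': "S = {x. n' \<bullet> (x - y) = 0}" by (simp add: m)
  have n'n': "n' \<bullet> n' = 1" using n' by (simp add: norm_eq_1)
  \<comment> \<open>The part of \<open>n\<close> along \<open>S\<close> is itself a direction in
    \<open>S\<close>, so it is orthogonal to \<open>n\<close> and must vanish.\<close>
  define r where "r = n - (n' \<bullet> n) *\<^sub>R n'"
  have r: "n' \<bullet> r = 0" by (simp add: r_def inner_diff_right n'n')
  then have "y + r \<in> S" "y \<in> S" by (simp_all add: S')
  then have "n \<bullet> r = 0" using n(2) by fastforce
  then have "r \<bullet> r = 0" using r by (simp add: r_def inner_diff_left)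
  then have nn': "n = (n' \<bullet> n) *\<^sub>R n'" by (simp add: r_def)
  moreover have pos: "n' \<bullet> n > 0" using gn \<open>g \<noteq> 0\<close> by (simp add: n'_def)
  ultimately have "n' \<bullet> n = 1" using n(1) n' by (metis abs_of_pos mult.right_neutral norm_scaleR)
  then have "n = n'" using nn' by simp
  moreover have "norm g > 0" using \<open>g \<noteq> 0\<close> by simp
  moreover have "A x + c = norm g * (n' \<bullet> (x - y))" for x
    unfolding gL by (subst gn') simp
  ultimately show ?thesis using that[of "norm g"] S' by simp
qed

text \<open>The foot of the perpendicular gives the upper bound, the Cauchy-Schwarz inequality the
  lower one.\<close>

lemma infdist_hyperplane:
  fixes n y x :: "'a::euclidean_space"
  assumes n: "norm n = 1" and "n \<bullet> (x - y) \<ge> 0"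
  shows "infdist x {x. n \<bullet> (x - y) = 0} = n \<bullet> (x - y)"
proof (rule antisym)
  let ?S = "{x. n \<bullet> (x - y) = 0}"
  have nn: "n \<bullet> n = 1" using n by (simp add: norm_eq_1)
  have "x - (n \<bullet> (x - y)) *\<^sub>R n \<in> ?S" by (simp add: inner_diff_right nn)
  from infdist_le[OF this, of x] show "infdist x ?S \<le> n \<bullet> (x - y)"
    using assms by (simp add: dist_norm)
  have "n \<bullet> (x - y) \<le> dist x a" if "a \<in> ?S" for a
  proof -
    have "n \<bullet> (x - y) = n \<bullet> (x - a)" using that by (simp add: inner_diff_right)
    also have "\<dots> \<le> norm n * norm (x - a)" by (rule norm_cauchy_schwarz)
    finally show ?thesis using n by (simp add: dist_norm)
  qed
  moreover have "y \<in> ?S" by simp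
  then have ne: "?S \<noteq> {}" by blast
  ultimately show "n \<bullet> (x - y) \<le> infdist x ?S"
    unfolding infdist_notempty[OF ne] by (intro cINF_greatest)
qed

lemma card_kuhn_simplex_le: "card (kuhn_simplex D l (u :: real^'n::finite) \<pi>) \<le> CARD('n) + 1"
  unfolding kuhn_simplex_def using card_image_le[of "{..CARD('n)}"] by simp

text \<open>A nonempty interior forces full affine dimension, and \<open>CARD('n) + 1\<close> points
  or fewer can reach it only if they are affinely independent.\<close>

lemma full_simplex_independent:
  fixes V :: "(real^'n) set"
  assumes "finite V" "card V \<le> CARD('n) + 1" "open_simplex V \<noteq> {}"
  shows "affine hull V = UNIV" "\<not> affine_dependent V"
proof -
  have "affine hull (convex hull V) = UNIV"
    using assms(3) by (intro affine_hull_nonempty_interior) (simp add: open_simplex_def)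
  then show hull: "affine hull V = UNIV" by simp
  have "aff_dim (affine hull V) = CARD('n)" unfolding hull by simp
  then have "aff_dim V = CARD('n)" by simp
  moreover have "aff_dim V \<le> int (card V) - 1" using aff_dim_le_card[OF assms(1)] .
  ultimately show "\<not> affine_dependent V"
    using assms(1,2) by (simp add: affine_independent_iff_card)
qed

text \<open>The interpolated signed distance is a single affine function on \<open>T\<close>. By
  \<open>level_set_normal\<close> it is a positive multiple of the height, which describes both
  sides and the signs at the vertices.\<close>

lemma cut_element:
  fixes \<Omega> S V :: "(real^'n::finite) set" and M :: "(real^'n) set set" and d :: "real^'n \<Rightarrow> real"
  defines "T \<equiv> open_simplex V"
  defines "\<Gamma>T \<equiv> discrete_interface \<Omega> M d \<inter> T"
  defines "Tp \<equiv> T \<inter> discrete_plus \<Omega> M d" and "Tm \<equiv> T \<inter> discrete_minus \<Omega> M d"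
  assumes mesh: "cartesian_mesh \<Omega> M" and V: "V \<in> M" and y: "y \<in> \<Gamma>T"
    and S: "hyperplane S" "\<Gamma>T \<subseteq> S"
    and n: "interface_normal (discrete_minus \<Omega> M d) (discrete_plus \<Omega> M d) \<Gamma>T S n"
  shows "cut_simplex V T Tp Tm \<Gamma>T d n y" "S = {x. n \<bullet> (x - y) = 0}"
proof -
  obtain lo hi G D where \<Omega>: "\<Omega> = box lo hi"
    and G: "\<forall>i. finite (G i) \<and> {lo $ i, hi $ i} \<subseteq> G i \<and> G i \<subseteq> {lo $ i..hi $ i}"
    and M: "M = kuhn_mesh G D"
    using mesh unfolding cartesian_mesh_def by blast
  obtain l u \<pi> where lu: "V = kuhn_simplex D l u \<pi>" "(l, u) \<in> grid_cells G"
    and \<pi>: "bij_betw \<pi> {..<CARD('n)} UNIV"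
    using V by (auto simp: M kuhn_mesh_def)
  have cell: "l $ i < u $ i" "l $ i \<in> G i" "u $ i \<in> G i" for i
    using lu(2) by (auto simp: grid_cells_def consecutive_def)
  have "convex hull V \<subseteq> cbox l u" unfolding lu(1) using cell by (intro kuhn_simplex_subset_cell) simp
  moreover have "l $ i \<in> {lo $ i..hi $ i}" "u $ i \<in> {lo $ i..hi $ i}" for i
    using G cell(2,3) by blast+
  then have "cbox l u \<subseteq> cbox lo hi"
    by (auto simp: mem_box_cart) (meson order_trans)+
  ultimately have "convex hull V \<subseteq> cbox lo hi" by (rule subset_trans)
  \<comment> \<open>The discrete sets are restricted to \<open>\<Omega>\<close>; by this inclusion
    the sign of the interpolant alone describes them inside \<open>T\<close>.\<close>
  from interior_mono[OF this] have "T \<subseteq> \<Omega>" by (simp add: T_def open_simplex_def \<Omega>)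
  have "finite V" "card V \<le> CARD('n) + 1"
    unfolding lu(1) using card_kuhn_simplex_le by (simp_all add: kuhn_simplex_def)
  moreover have "T \<noteq> {}" using y by (auto simp: \<Gamma>T_def)
  ultimately have hull: "affine hull V = UNIV" and indep: "\<not> affine_dependent V"
    using full_simplex_independent unfolding T_def by blast+
  obtain A c where A: "linear A" "lin_interp V d = (\<lambda>x. A x + c)"
    using lin_interp_P1[OF indep hull] by (rule P1_E)
  have interp: "mesh_interp M d x = A x + c" if "x \<in> T" for x
    using mesh_interp_kuhn that V A(2) unfolding M T_def by metis
  have \<Gamma>T: "\<Gamma>T = {x\<in>T. A x + c = 0}" and Tp: "Tp = {x\<in>T. A x + c > 0}" and Tm: "Tm = {x\<in>T. A x + c < 0}"
    using \<open>T \<subseteq> \<Omega>\<close> interp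
    by (auto simp: \<Gamma>T_def Tp_def Tm_def discrete_interface_def discrete_plus_def discrete_minus_def)
  have yT: "y \<in> T" "A y + c = 0" using y by (auto simp: \<Gamma>T)
  have T: "open T" by (simp add: T_def open_simplex_def)
  have norm: "norm n = 1" "\<forall>x\<in>S. \<forall>x'\<in>S. n \<bullet> (x - x') = 0"
    and sides: "\<forall>\<^sub>F e in at_right 0. y + e *\<^sub>R n \<in> discrete_plus \<Omega> M d \<and> y - e *\<^sub>R n \<in> discrete_minus \<Omega> M d"
    using n y by (auto simp: interface_normal_def)
  from sides have "\<forall>\<^sub>F e in at_right 0. A (y + e *\<^sub>R n) + c > 0"
    using open_small_step[OF T yT(1), of n]
  proof eventually_elim
    case (elim e)
    then have "y + e *\<^sub>R n \<in> Tp" by (simp add: Tp_def)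
    then show ?case by (simp add: Tp)
  qed
  then obtain \<kappa> where \<kappa>: "\<kappa> > 0" "\<And>x. A x + c = \<kappa> * (n \<bullet> (x - y))"
    and S': "S = {x. n \<bullet> (x - y) = 0}"
    using level_set_normal[OF A(1) T yT S(1) _ norm] S(2) unfolding \<Gamma>T by blast
  have edges: "\<exists>a\<in>V. \<exists>b\<in>V. \<exists>\<tau>. \<tau> \<noteq> 0 \<and> b - a = \<tau> *\<^sub>R axis j 1" for j
    using kuhn_simplex_axis_edge[of l u \<pi> D j] cell(1) \<pi> unfolding lu(1) by metis
  have sign: "d a > 0 \<longleftrightarrow> n \<bullet> (a - y) > 0" if "a \<in> V" for a
  proof -
    have "d a = \<kappa> * (n \<bullet> (a - y))" using lin_interp_vertex[OF indep hull that, of d] A(2) \<kappa>(2) by simp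
    then show ?thesis using \<kappa>(1) by (simp add: zero_less_mult_iff)
  qed
  show "S = {x. n \<bullet> (x - y) = 0}" by (rule S')
  show "cut_simplex V T Tp Tm \<Gamma>T d n y"
    using \<kappa>(1) by unfold_locales
      (simp_all add: indep hull edges T yT(1) norm(1) sign Tp Tm \<Gamma>T \<kappa>(2) zero_less_mult_iff mult_less_0_iff)
qed

theorem lemma2p8:
  fixes \<Omega> \<Gamma> \<Omega>m \<Omega>p T Tp Tm \<Gamma>T S V :: "(real^'n::finite) set"
    and \<F> :: "(real^'n) set set set" and M :: "(real^'n) set set"
    and d z w :: "real^'n \<Rightarrow> real"
    and \<mu>p \<mu>m h\<^sub>0 :: real
    and n xT :: "real^'n" and t :: "nat \<Rightarrow> real^'n"
    and N :: nat
  assumes N: "N = CARD('n)" "N \<in> {2, 3}"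
    and interface: "interface_problem \<Omega> \<Gamma> \<Omega>m \<Omega>p"
    and mu: "\<mu>p > 0" "\<mu>m > 0"
    and d: "d = signed_dist \<Gamma> \<Omega>m"
    and meshes: "\<forall>M\<in>\<F>. cartesian_mesh \<Omega> M" "shape_regular \<F>"
    and threshold: "h\<^sub>0 > 0" "\<forall>M\<in>\<F>. mesh_size M < h\<^sub>0 \<longrightarrow> resolves_interface \<Omega> \<Gamma> M d"
    and M: "M \<in> \<F>" "mesh_size M < h\<^sub>0"
    and V: "V \<in> interface_elements M \<Gamma>"
    and T: "T = open_simplex V" "Tp = T \<inter> discrete_plus \<Omega> M d" "Tm = T \<inter> discrete_minus \<Omega> M d"
    and GammaT: "\<Gamma>T = discrete_interface \<Omega> M d \<inter> T" "\<Gamma>T \<noteq> {}"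
    and S: "hyperplane S" "\<Gamma>T \<subseteq> S"
    and n: "interface_normal (discrete_minus \<Omega> M d) (discrete_plus \<Omega> M d) \<Gamma>T S n"
    and t: "\<forall>i\<in>{1..N-1}. norm (t i) = 1 \<and> t i \<bullet> n = 0"
           "\<forall>i\<in>{1..N-1}. \<forall>j\<in>{1..N-1}. i \<noteq> j \<longrightarrow> t i \<bullet> t j = 0"
    and xT: "xT \<in> \<Gamma>T"
    and zw: "z = z_fun Tp" "w = w_fun Tp S"
  shows
    "(\<forall>(\<alpha> :: real^'n \<Rightarrow> real^'n) (\<beta> :: real^'n \<Rightarrow> real).
       \<exists>!(v, q). (v, q) \<in> IFE_space \<mu>p \<mu>m Tp Tm \<Gamma>T xT n \<and>
         (\<forall>a\<in>V. vertex_value d Tp Tm v a = \<alpha> a \<and> vertex_value d Tp Tm q a = \<beta> a)) \<and>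
     (\<forall>(v, q) \<in> IFE_space \<mu>p \<mu>m Tp Tm \<Gamma>T xT n.
       let Iv = lin_interp V (vertex_value d Tp Tm v);
           Iq = lin_interp V (vertex_value d Tp Tm q);
           Iw = lin_interp V (vertex_value d Tp Tm w);
           Iz = lin_interp V (vertex_value d Tp Tm z);
           determines = (\<lambda>c :: nat \<Rightarrow> real. \<forall>x\<in>T.
             (\<forall>i\<in>{1..N-1}. (1 + (\<mu>m / \<mu>p - 1) * (grad Iw x \<bullet> n)) * c i
                = t i \<bullet> (stress (\<mu>m / \<mu>p - 1) Iv (\<lambda>_. 0) x *v n)) \<and>
             c N = n \<bullet> (stress (\<mu>m - \<mu>p) Iv (\<lambda>_. 0) x *v n))
       in (\<exists>!c. c \<in> extensional {1..N} \<and> determines c) \<and>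
          (\<forall>c. determines c \<longrightarrow>
             (\<forall>x \<in> Tp \<union> Tm.
                (v x, q x) = (Iv x, Iq x)
                  + (\<Sum>i=1..N-1. ((c i * (w x - Iw x)) *\<^sub>R t i, 0))
                  + (0, c N * (z x - Iz x)))))"
proof -
  have mesh: "cartesian_mesh \<Omega> M" using meshes(1) M(1) by blast
  have "V \<in> M" using V by (simp add: interface_elements_def)
  note cut = cut_element[OF mesh this, of xT d S n, folded T(1), folded T(2,3) GammaT(1), OF xT S n]
  interpret L: cut_simplex V T Tp Tm \<Gamma>T d n xT by (rule cut(1))
  have z: "z = L.z" by (simp add: zw z_fun_def[abs_def] L.z_def[abs_def])
  \<comment> \<open>Identifies the distance in \<open>w_fun\<close> with the height used in the
    locale.\<close>
  have "infdist x S = n \<bullet> (x - xT)" if "x \<in> Tp" for x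
    unfolding cut(2) using that by (intro infdist_hyperplane[OF L.n]) (simp add: L.Tp)
  then have w: "w = L.w" by (auto simp: zw w_fun_def fun_eq_iff L.w_def L.height_def)
  have Iw: "lin_interp V (vertex_value d Tp Tm w) = L.Iw" unfolding w L.Iw_def ..
  have Iz: "lin_interp V (vertex_value d Tp Tm z) = L.Iz" unfolding z L.Iz_def ..
  have t': "\<forall>i\<in>{1..N-1}. t i \<bullet> n = 0" using t(1) by blast
  show ?thesis
  proof (intro conjI allI ballI, goal_cases)
    case 1
    then show ?case by (rule L.IFE_unisolvent[OF mu])
  next
    case (2 p)
    then obtain v q where p: "p = (v, q)" and vq: "(v, q) \<in> IFE_space \<mu>p \<mu>m Tp Tm \<Gamma>T xT n"
      by (cases p) simp
    let ?Iv = "lin_interp V (vertex_value d Tp Tm v)"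
    let ?Iq = "lin_interp V (vertex_value d Tp Tm q)"
    let ?det = "\<lambda>c :: nat \<Rightarrow> real. \<forall>x\<in>T.
           (\<forall>i\<in>{1..N-1}. (1 + (\<mu>m / \<mu>p - 1) * (grad L.Iw x \<bullet> n)) * c i
              = t i \<bullet> (stress (\<mu>m / \<mu>p - 1) ?Iv (\<lambda>_. 0) x *v n)) \<and>
           c N = n \<bullet> (stress (\<mu>m - \<mu>p) ?Iv (\<lambda>_. 0) x *v n)"
    obtain a \<delta> where a: "a \<bullet> n = 0"
      and v: "\<And>x. x \<in> Tp \<union> Tm \<Longrightarrow> v x = ?Iv x + (w x - L.Iw x) *\<^sub>R a"
      and q: "\<And>x. x \<in> Tp \<union> Tm \<Longrightarrow> q x = ?Iq x - \<delta> * (z x - L.Iz x)"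
      and ci: "\<And>x i r. i \<in> {1..N-1} \<Longrightarrow> (1 + (\<mu>m / \<mu>p - 1) * (grad L.Iw x \<bullet> n)) * r
        = t i \<bullet> (stress (\<mu>m / \<mu>p - 1) ?Iv (\<lambda>_. 0) x *v n) \<longleftrightarrow> r = a \<bullet> t i"
      and cN: "\<And>x. n \<bullet> (stress (\<mu>m - \<mu>p) ?Iv (\<lambda>_. 0) x *v n) = - \<delta>"
      by (rule L.IFE_representation[OF vq mu t', folded w z]) (rule that)
    \<comment> \<open>The defining equations are quantified over \<open>T\<close>; with
      \<open>T\<close> nonempty they pin down the coefficients.\<close>
    have "\<exists>x. x \<in> T" using L.yT by blast
    then have det: "?det c \<longleftrightarrow> (\<forall>i\<in>{1..N-1}. c i = a \<bullet> t i) \<and> c N = - \<delta>" for c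
      by (simp add: ci cN)
    \<comment> \<open>Indices below \<open>N\<close> hold the tangential coordinates of
      \<open>a\<close>, and the last one the pressure coefficient, with a minus sign because
      \<open>z\<close> is \<open>-1\<close> on the plus side.\<close>
    define c0 where "c0 = (\<lambda>i\<in>{1..N}. if i = N then - \<delta> else a \<bullet> t i)"
    have unique: "\<exists>!c. c \<in> extensional {1..N} \<and> ?det c"
      unfolding det
    proof (rule ex1I[of _ c0])
      show "c0 \<in> extensional {1..N} \<and> (\<forall>i\<in>{1..N-1}. c0 i = a \<bullet> t i) \<and> c0 N = - \<delta>"
        using N(2) by (auto simp: c0_def)
      fix c assume c: "c \<in> extensional {1..N} \<and> (\<forall>i\<in>{1..N-1}. c i = a \<bullet> t i) \<and> c N = - \<delta>"
      show "c = c0"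
      proof (rule extensionalityI[of _ "{1..N}"])
        fix i assume "i \<in> {1..N}"
        then show "c i = c0 i" using c by (cases "i = N") (auto simp: c0_def)
      qed (use c in \<open>simp_all add: c0_def\<close>)
    qed
    have rep: "(v x, q x) = (?Iv x, ?Iq x)
                + (\<Sum>i=1..N-1. ((c i * (w x - L.Iw x)) *\<^sub>R t i, 0))
                + (0, c N * (z x - L.Iz x))" if "?det c" "x \<in> Tp \<union> Tm" for c x
    proof -
      have c: "\<forall>i\<in>{1..N-1}. c i = a \<bullet> t i" "c N = - \<delta>" using that(1) unfolding det by blast+
      have "a = (\<Sum>i=1..N-1. (a \<bullet> t i) *\<^sub>R t i)"
        using orthonormal_complement_expansion[OF L.n a] t unfolding N(1) by blast
      also have "\<dots> = (\<Sum>i=1..N-1. c i *\<^sub>R t i)" using c by (intro sum.cong) simp_all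
      finally have "(w x - L.Iw x) *\<^sub>R a = (\<Sum>i=1..N-1. (c i * (w x - L.Iw x)) *\<^sub>R t i)"
        by (simp add: scaleR_sum_right mult.commute)
      then show ?thesis
        using v[OF that(2)] q[OF that(2)] c(2) by (simp add: prod_eq_iff fst_sum snd_sum)
    qed
    show ?case
      unfolding p prod.case Let_def Iw Iz
    proof (intro conjI allI impI ballI)
      show "\<exists>!c. c \<in> extensional {1..N} \<and> ?det c" by (rule unique)
    qed (rule rep)
  qed
qed

end
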